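(* There exists $\varepsilon_0>0$ such that the following holds for every constant $\varepsilon\neq0$ with $|\varepsilon|<\varepsilon_0$. Let $$a(x)=\begin{pmatrix}1+\frac{\varepsilon x_2^2}{|x|^2}&-\frac{\varepsilon x_1x_2}{|x|^2}\\[2pt]-\frac{\varepsilon x_1x_2}{|x|^2}&1+\frac{\varepsilon x_1^2}{|x|^2}\end{pmatrix},\qquad x=(x_1,x_2)\in\mathbb{R}^2\setminus\{0\},$$ and let $v\ge0$ be a solution of $\sum_{i,j}a_{ij}v_{ij}=\chi_{\{v>0\}}$ in $B_1\subset\mathbb{R}^2$. Assume that $0\in\partial\{v>0\}$ and that $v$ is non-degenerate at $0$. Then $\partial\{v>0\}$ cannot be differentiable at the origin.
   Context: $B_1$ is the open unit disc centred at the origin, $v_{ij}=\partial^2_{ij}v$, and $\chi_{\{v>0\}}$ is the characteristic function of $\{v>0\}$. A solution is a strong solution: $v\in W^{2,2}_{loc}(B_1)$ (here $n=2$) and the equation holds almost everywhere. For a sequence of positive numbers $r_k\to0$, the blow-up sequence of $v$ at $0$ is $v_{r_k}(x)=v(r_kx)/r_k^2$; a blow-up limit at $0$ is a limit in $C^1_{loc}(\mathbb{R}^2)$ of a subsequence of such a blow-up sequence. The function $v$ is non-degenerate at $0\in\partial\{v>0\}$ if there exists a sequence of positive numbers $r_k\to0$ such that the corresponding blow-up limit is not identically zero. "$\partial\{v>0\}$ is differentiable at the origin" means that, near the origin and up to a rotation of coordinates, $\{v>0\}$ coincides with $\{x_2<\varphi(x_1)\}$ for some function $\varphi$ with $\varphi(0)=0$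 that is differentiable at $0$ with $\varphi'(0)=0$. *)

theory Defs
  imports "HOL-Analysis.Analysis"
begin

definition partial_deriv :: "'n \<Rightarrow> (real ^ 'n::finite \<Rightarrow> real) \<Rightarrow> real ^ 'n \<Rightarrow> real" where
  "partial_deriv i f x = frechet_derivative f (at x) (axis i 1)"

(* Meant for open U. *)
primrec Ck_on :: "nat \<Rightarrow> (real ^ 'n::finite) set \<Rightarrow> (real ^ 'n \<Rightarrow> real) \<Rightarrow> bool" where
  "Ck_on 0 U f \<longleftrightarrow> continuous_on U f"
| "Ck_on (Suc k) U f \<longleftrightarrow>
     (\<forall>x\<in>U. f differentiable (at x)) \<and> (\<forall>i. Ck_on k U (partial_deriv i f))"

definition test_function :: "(real ^ 'n::finite) set \<Rightarrow> (real ^ 'n \<Rightarrow> real) \<Rightarrow> bool" where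
  "test_function U \<phi> \<longleftrightarrow> (\<forall>k. Ck_on k UNIV \<phi>) \<and>
     compact (closure {x. \<phi> x \<noteq> 0}) \<and> closure {x. \<phi> x \<noteq> 0} \<subseteq> U"

definition L1_loc :: "(real ^ 'n::finite) set \<Rightarrow> (real ^ 'n \<Rightarrow> real) \<Rightarrow> bool" where
  "L1_loc U f \<longleftrightarrow> (\<forall>K. compact K \<and> K \<subseteq> U \<longrightarrow> integrable (lebesgue_on K) f)"

definition L2_loc :: "(real ^ 'n::finite) set \<Rightarrow> (real ^ 'n \<Rightarrow> real) \<Rightarrow> bool" where
  "L2_loc U f \<longleftrightarrow> (\<forall>K. compact K \<and> K \<subseteq> U \<longrightarrow>
     f \<in> borel_measurable (lebesgue_on K) \<and> integrable (lebesgue_on K) (\<lambda>x. (f x)\<^sup>2))"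

definition weak_partial_deriv ::
  "(real ^ 'n::finite) set \<Rightarrow> 'n \<Rightarrow> (real ^ 'n \<Rightarrow> real) \<Rightarrow> (real ^ 'n \<Rightarrow> real) \<Rightarrow> bool" where
  "weak_partial_deriv U i f g \<longleftrightarrow> L1_loc U f \<and> L1_loc U g \<and>
     (\<forall>\<phi>. test_function U \<phi> \<longrightarrow>
        (\<integral>x. f x * partial_deriv i \<phi> x \<partial>lebesgue_on U) = - (\<integral>x. g x * \<phi> x \<partial>lebesgue_on U))"

(* f lies in W^{2,2}_loc(U), with weak gradient G and weak Hessian H; the latter two are
   determined by f up to null sets. *)
definition W22_loc_with ::
  "(real ^ 'n::finite) set \<Rightarrow> (real ^ 'n \<Rightarrow> real) \<Rightarrow> (real ^ 'n \<Rightarrow> real ^ 'n)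
    \<Rightarrow> (real ^ 'n \<Rightarrow> real ^ 'n ^ 'n) \<Rightarrow> bool" where
  "W22_loc_with U f G H \<longleftrightarrow> L2_loc U f \<and>
     (\<forall>i. L2_loc U (\<lambda>x. G x $ i) \<and> weak_partial_deriv U i f (\<lambda>x. G x $ i)) \<and>
     (\<forall>i j. L2_loc U (\<lambda>x. H x $ i $ j) \<and>
        weak_partial_deriv U j (\<lambda>x. G x $ i) (\<lambda>x. H x $ i $ j))"

definition positivity_set :: "(real ^ 2 \<Rightarrow> real) \<Rightarrow> (real ^ 2) set" where
  "positivity_set v = {x \<in> ball 0 1. v x > 0}"

(* The value at the origin, where division by zero makes this the identity, is irrelevant. *)
definition coeff_matrix :: "real \<Rightarrow> real ^ 2 \<Rightarrow> real ^ 2 ^ 2" where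
  "coeff_matrix \<epsilon> x = vector
     [vector [1 + \<epsilon> * (x $ 2)\<^sup>2 / (norm x)\<^sup>2, - (\<epsilon> * x $ 1 * x $ 2 / (norm x)\<^sup>2)],
      vector [- (\<epsilon> * x $ 1 * x $ 2 / (norm x)\<^sup>2), 1 + \<epsilon> * (x $ 1)\<^sup>2 / (norm x)\<^sup>2]]"

(* v is a pointwise representative of its W^{2,2}_loc class.  No continuity is required here;
   the C^1_loc convergence in nondegenerate_at_0 forces it near the origin. *)
definition strong_solution :: "(real ^ 2 \<Rightarrow> real ^ 2 ^ 2) \<Rightarrow> (real ^ 2 \<Rightarrow> real) \<Rightarrow> bool" where
  "strong_solution a v \<longleftrightarrow> (\<exists>G H. W22_loc_with (ball 0 1) v G H \<and>
     (AE x in lebesgue_on (ball 0 1).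
        (\<Sum>i\<in>UNIV. \<Sum>j\<in>UNIV. a x $ i $ j * H x $ i $ j) = indicator (positivity_set v) x))"

(* The f k need only be C^1 near a given compact set for large k, since the domains of a
   blow-up sequence only exhaust the plane. *)
definition C1_loc_limit :: "(nat \<Rightarrow> real ^ 'n::finite \<Rightarrow> real) \<Rightarrow> (real ^ 'n \<Rightarrow> real) \<Rightarrow> bool" where
  "C1_loc_limit f g \<longleftrightarrow> Ck_on 1 UNIV g \<and>
     (\<forall>K. compact K \<longrightarrow>
        (\<forall>\<^sub>F k in sequentially. \<exists>U. open U \<and> K \<subseteq> U \<and> Ck_on 1 U (f k)) \<and>
        uniform_limit K f g sequentially \<and>
        (\<forall>i. uniform_limit K (\<lambda>k. partial_deriv i (f k)) (partial_deriv i g) sequentially))"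

definition rescale :: "(real ^ 2 \<Rightarrow> real) \<Rightarrow> real \<Rightarrow> real ^ 2 \<Rightarrow> real" where
  "rescale v r x = v (r *\<^sub>R x) / r\<^sup>2"

definition blow_up_limit :: "(real ^ 2 \<Rightarrow> real) \<Rightarrow> (nat \<Rightarrow> real) \<Rightarrow> (real ^ 2 \<Rightarrow> real) \<Rightarrow> bool" where
  "blow_up_limit v r v0 \<longleftrightarrow>
     (\<exists>s :: nat \<Rightarrow> nat. strict_mono s \<and> C1_loc_limit (\<lambda>k. rescale v (r (s k))) v0)"

definition nondegenerate_at_0 :: "(real ^ 2 \<Rightarrow> real) \<Rightarrow> bool" where
  "nondegenerate_at_0 v \<longleftrightarrow>
     (\<exists>r v0. (\<forall>k. r k > 0) \<and> r \<longlonglongrightarrow> 0 \<and> blow_up_limit v r v0 \<and> (\<exists>x. v0 x \<noteq> 0))"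

definition boundary_differentiable_at_0 :: "(real ^ 2) set \<Rightarrow> bool" where
  "boundary_differentiable_at_0 S \<longleftrightarrow>
     (\<exists>Q \<phi>. rotation_matrix Q \<and> \<phi> 0 = 0 \<and> (\<phi> has_real_derivative 0) (at 0) \<and>
        (\<forall>\<^sub>F x in nhds 0. x \<in> S \<longleftrightarrow> (Q *v x) $ 2 < \<phi> ((Q *v x) $ 1)))"

end

theory Submission
  imports Defs
begin

text \<open>
  Multiplied by $|x|^2$, the operator $a_{ij} \partial_{ij}$ has polynomial coefficients and reads
  $\partial_{ss} + \varepsilon \partial_s + (1 + \varepsilon) \partial_{\vartheta\vartheta}$ in
  $s = \ln |x|$ and the polar angle $\vartheta$. With $\mu^2 = (4 + 2 \varepsilon) / (1 + \varepsilon)$,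
  the function $|x|^{-4} \cos(\mu \vartheta)$ is annihilated by its adjoint. Suppose that near $0$ the
  positivity set $S$ lies in a slightly opened half-plane. Testing the equation against
  $|x|^{-4} \cos(\mu \vartheta)$ times a radial cutoff equal to $Z(s - a) - Z(s - a + 1)$ gives
  $J(a) - J(a - 1) = \int_S |x|^{-2} (Z(s - a) - Z(s - a + 1)) \cos(\mu \vartheta)$, where $J(a)$ is the
  integral of $v$ against a weight of size $e^{-4a}$ living on $e^a \le |x| \le e^{a+1}$. If the free
  boundary is differentiable at $0$, the right-hand side tends, as $a \to -\infty$, to the same integral over the
  half-plane, which is nonzero because $\mu \ne 2$. Hence $J$ grows linearly, that is,
  $v$ exceeds quadratic growth by a logarithm. Along a convergent blow-up sequence, however, $v(x) = O(r_k^2)$ for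
  $|x| \le e r_k$, so $J(\ln r_k)$ stays bounded.
\<close>

section \<open>Calculus of smooth functions\<close>

text \<open>The number \<open>\<mu>\<close> is a resonance. Away from the branch cut, |x|^2
  cos(\<mu> \<theta>) solves the homogeneous equation and has the same degree 2 as a half-plane
  profile, so a right-hand side supported on a half-plane forces a term |x|^2 ln |x| unless it is
  orthogonal to this mode. Orthogonality means that cos(\<mu> \<theta>) has integral zero over
  (-pi/2, pi/2), that is sin(\<mu> pi/2) = 0. For \<epsilon> = 0 one has \<mu> = 2 and it holds, as
  it must, since the Laplacian has half-plane solutions; every small nonzero \<epsilon> breaks it.
  The exponent -4 is dual to 2: the adjoint with respect to ds d\<theta> has the factor exp(-2 s),
  and dx = exp(2 s) ds d\<theta> contributes another exp(-2 s). In general \<open>\<mu>\<close> is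
  not an integer, so cos(\<mu> \<theta>) is not single-valued around the origin. It is cut off in
  the angle, inside a cone where v vanishes near 0. Using a difference of two radial cutoffs keeps
  the support away from the origin, where |x|^-4 is singular.\<close>

definition smooth_on :: "(real ^ 'n::finite) set \<Rightarrow> (real ^ 'n \<Rightarrow> real) \<Rightarrow> bool" where
  "smooth_on U f \<longleftrightarrow> (\<forall>k. Ck_on k U f)"

lemma partial_deriv_eqI:
  assumes "(f has_derivative f') (at x)"
  shows "partial_deriv i f x = f' (axis i 1)"
  using frechet_derivative_at[OF assms] by (simp add: partial_deriv_def)

lemma partial_deriv_cong:
  assumes "open U" "x \<in> U" "\<And>y. y \<in> U \<Longrightarrow> f y = g y"
  shows "partial_deriv i f x = partial_deriv i g x"
proof -
  have "(f has_derivative h) (at x) \<longleftrightarrow> (g has_derivative h) (at x)" for h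
    using has_derivative_transform_within_open[of f h x UNIV U g]
      has_derivative_transform_within_open[of g h x UNIV U f] assms by auto
  then show ?thesis by (simp add: partial_deriv_def frechet_derivative_def)
qed

lemma Ck_on_cong:
  assumes "open U" "\<And>x. x \<in> U \<Longrightarrow> f x = g x" "Ck_on k U f"
  shows "Ck_on k U g"
  using assms(2,3)
proof (induction k arbitrary: f g)
  case 0
  then show ?case by (metis Ck_on.simps(1) continuous_on_cong)
next
  case (Suc k)
  have "g differentiable (at x)" if "x \<in> U" for x
    using Suc.prems that assms(1) unfolding differentiable_def
    by (metis Ck_on.simps(2) differentiable_def has_derivative_transform_within_open)
  moreover have "Ck_on k U (partial_deriv i g)" for i
  proof (rule Suc.IH)
    show "Ck_on k U (partial_deriv i f)" using Suc.prems by simp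
    show "partial_deriv i f x = partial_deriv i g x" if "x \<in> U" for x
      using partial_deriv_cong[OF assms(1) that] Suc.prems by blast
  qed
  ultimately show ?case by simp
qed

lemma Ck_on_SucD: "Ck_on (Suc k) U f \<Longrightarrow> Ck_on k U f"
proof (induction k arbitrary: f)
  case 0
  then show ?case
    by (auto intro!: continuous_at_imp_continuous_on differentiable_imp_continuous_within)
next
  case (Suc k)
  then show ?case by (metis Ck_on.simps(2))
qed

lemma Ck_on_subset: "Ck_on k U f \<Longrightarrow> V \<subseteq> U \<Longrightarrow> Ck_on k V f"
  by (induction k arbitrary: f) (auto intro: continuous_on_subset)

lemma Ck_on_Union:
  assumes "\<And>U. U \<in> \<U> \<Longrightarrow> open U" "\<And>U. U \<in> \<U> \<Longrightarrow> Ck_on k U f"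
  shows "Ck_on k (\<Union>\<U>) f"
  using assms(2)
proof (induction k arbitrary: f)
  case 0
  then show ?case using continuous_on_open_Union[of \<U> f] assms(1) by simp
next
  case (Suc k)
  then show ?case by auto
qed

lemma Ck_on_const: "Ck_on k (U :: (real ^ 'n::finite) set) (\<lambda>x. c)"
proof (induction k arbitrary: c)
  case (Suc k)
  have "partial_deriv i (\<lambda>x. c) = (\<lambda>x. 0)" for i :: 'n
    by (auto simp: partial_deriv_def)
  then show ?case using Suc by simp
qed simp

lemma partial_deriv_add:
  assumes "f differentiable (at x)" "g differentiable (at x)"
  shows "partial_deriv i (\<lambda>x. f x + g x) x = partial_deriv i f x + partial_deriv i g x"
  using partial_deriv_eqI[OF has_derivative_add[OF assms[unfolded frechet_derivative_works]]]
  by (simp add: partial_deriv_def)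

lemma partial_deriv_mult:
  assumes "f differentiable (at x)" "g differentiable (at x)"
  shows "partial_deriv i (\<lambda>x. f x * g x) x = f x * partial_deriv i g x + partial_deriv i f x * g x"
  using partial_deriv_eqI[OF has_derivative_mult[OF assms[unfolded frechet_derivative_works]]]
  by (simp add: partial_deriv_def)

lemma partial_deriv_compose:
  assumes "f differentiable (at x)" "(g has_real_derivative d) (at (f x))"
  shows "partial_deriv i (\<lambda>x. g (f x)) x = d * partial_deriv i f x"
proof -
  have "(f has_derivative frechet_derivative f (at x)) (at x)"
    using assms(1) frechet_derivative_works by blast
  from has_derivative_compose[OF this, of g "(*) d"] assms(2)
  show ?thesis by (subst partial_deriv_eqI) (auto simp: has_field_derivative_def partial_deriv_def)
qed

lemma differentiable_compose_real:
  fixes f :: "real ^ 'n::finite \<Rightarrow> real"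
  assumes "f differentiable (at x)" "(g has_real_derivative d) (at (f x))"
  shows "(\<lambda>x. g (f x)) differentiable (at x)"
  using assms differentiable_chain_at[of f x g]
  by (auto simp: o_def real_differentiable_def has_field_derivative_def differentiable_def)

lemma partial_deriv_coord: "partial_deriv i (\<lambda>x. x $ j) x = (if i = j then 1 else 0)"
proof -
  have "((\<lambda>x. x $ j) has_derivative (\<lambda>x. x $ j)) (at x)"
    by (simp add: bounded_linear_imp_has_derivative bounded_linear_vec_nth)
  then show ?thesis by (simp add: partial_deriv_eqI axis_def)
qed

lemma differentiable_coord: "(\<lambda>x::real^'n::finite. x $ j) differentiable (at x)"
  using bounded_linear_imp_differentiable bounded_linear_vec_nth by blast

lemma Ck_on_coord: "Ck_on k U (\<lambda>x. x $ j)"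
proof (cases k)
  case 0
  then show ?thesis by (simp add: continuous_on_component)
next
  case (Suc m)
  have "partial_deriv i (\<lambda>x. x $ j) = (\<lambda>x. if i = j then 1 else 0)" for i
    by (auto simp: partial_deriv_coord)
  then show ?thesis using Suc by (simp add: differentiable_coord Ck_on_const)
qed

lemma Ck_on_add:
  assumes "open U"
  shows "Ck_on k U f \<Longrightarrow> Ck_on k U g \<Longrightarrow> Ck_on k U (\<lambda>x. f x + g x)"
proof (induction k arbitrary: f g)
  case 0
  then show ?case by (simp add: continuous_on_add)
next
  case (Suc k)
  then have "Ck_on k U (\<lambda>x. partial_deriv i f x + partial_deriv i g x)" for i by simp
  then have "Ck_on k U (partial_deriv i (\<lambda>x. f x + g x))" for i
    by (rule Ck_on_cong[OF assms, rotated]) (use Suc.prems in \<open>simp add: partial_deriv_add\<close>)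
  then show ?case using Suc.prems by (simp add: differentiable_add)
qed

lemma Ck_on_mult:
  assumes "open U"
  shows "Ck_on k U f \<Longrightarrow> Ck_on k U g \<Longrightarrow> Ck_on k U (\<lambda>x. f x * g x)"
proof (induction k arbitrary: f g)
  case 0
  then show ?case by (simp add: continuous_on_mult)
next
  case (Suc k)
  have "Ck_on k U (\<lambda>x. f x * partial_deriv i g x + partial_deriv i f x * g x)" for i
    using Suc.prems by (intro Ck_on_add Suc.IH assms) (auto intro: Ck_on_SucD simp del: Ck_on.simps, auto)
  then have "Ck_on k U (partial_deriv i (\<lambda>x. f x * g x))" for i
    by (rule Ck_on_cong[OF assms, rotated]) (use Suc.prems in \<open>simp add: partial_deriv_mult\<close>)
  then show ?case using Suc.prems by simp
qed

text \<open>The outer function enters through the sequence \<open>D\<close> of all its derivatives.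
  The conclusion is stated for every \<open>D n\<close> because the induction on k trades
  \<open>D n\<close> for \<open>D (Suc n)\<close>.\<close>

lemma Ck_on_compose:
  assumes "open U" "\<And>n t. t \<in> V \<Longrightarrow> (D n has_real_derivative D (Suc n) t) (at t)"
    and "\<And>x. x \<in> U \<Longrightarrow> f x \<in> V"
  shows "Ck_on k U f \<Longrightarrow> Ck_on k U (\<lambda>x. D n (f x))"
proof (induction k arbitrary: n)
  case 0
  have "continuous_on V (D n)" for n
    using assms(2) by (meson DERIV_continuous_on has_field_derivative_at_within)
  then show ?case using 0 assms(3) continuous_on_compose2[of V "D n" U f] by auto
next
  case (Suc k)
  have "Ck_on k U (partial_deriv i (\<lambda>x. D n (f x)))" for i
  proof (rule Ck_on_cong[OF assms(1)])
    show "Ck_on k U (\<lambda>x. D (Suc n) (f x) * partial_deriv i f x)"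
      by (intro Ck_on_mult assms(1) Suc.IH Ck_on_SucD[OF Suc.prems]) (use Suc.prems in simp)
    show "D (Suc n) (f x) * partial_deriv i f x = partial_deriv i (\<lambda>x. D n (f x)) x"
      if "x \<in> U" for x
      using partial_deriv_compose[of f x "D n" "D (Suc n) (f x)"] assms(2)[OF assms(3)[OF that]]
        Suc.prems that by simp
  qed
  moreover have "(\<lambda>x. D n (f x)) differentiable (at x)" if "x \<in> U" for x
    using Suc.prems that assms(2)[OF assms(3)[OF that]] by (auto intro: differentiable_compose_real)
  ultimately show ?case by simp
qed

section \<open>Closure properties of infinitely differentiable functions\<close>

lemma smooth_on_cong:
  "\<lbrakk>smooth_on U f; open U; \<And>x. x \<in> U \<Longrightarrow> f x = g x\<rbrakk> \<Longrightarrow> smooth_on U g"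
  by (simp add: smooth_on_def Ck_on_cong[of U f g])

lemma smooth_on_subset: "smooth_on U f \<Longrightarrow> V \<subseteq> U \<Longrightarrow> smooth_on V f"
  by (simp add: smooth_on_def Ck_on_subset[of _ U f V])

lemma smooth_on_Un:
  assumes "open U" "open V" "smooth_on U f" "smooth_on V f"
  shows "smooth_on (U \<union> V) f"
  using Ck_on_Union[of "{U, V}"] assms by (auto simp: smooth_on_def)

lemma smooth_on_imp_continuous_on: "smooth_on U f \<Longrightarrow> continuous_on U f"
  unfolding smooth_on_def by (drule spec[of _ 0]) simp

lemma smooth_on_imp_differentiable: "smooth_on U f \<Longrightarrow> x \<in> U \<Longrightarrow> f differentiable (at x)"
  unfolding smooth_on_def by (drule spec[of _ "Suc 0"]) simp

lemma smooth_on_partial_deriv: "smooth_on U f \<Longrightarrow> smooth_on U (partial_deriv i f)"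
  unfolding smooth_on_def by (rule allI, drule_tac x = "Suc k" in spec) simp

text \<open>Serves functions that are not built by the algebraic rules but whose gradient is, such
  as the logarithm of the norm and the polar angle, whose partial derivatives are rational.\<close>

lemma smooth_onI:
  assumes "open U" "\<And>x. x \<in> U \<Longrightarrow> f differentiable (at x)"
    and "\<And>i x. x \<in> U \<Longrightarrow> partial_deriv i f x = g i x" "\<And>i. smooth_on U (g i)"
  shows "smooth_on U f"
  unfolding smooth_on_def
proof
  fix k
  have "Ck_on (Suc k) U f"
    using assms Ck_on_cong[OF assms(1), of "g _" "partial_deriv _ f"] by (auto simp: smooth_on_def)
  then show "Ck_on k U f" by (rule Ck_on_SucD)
qed

lemma smooth_on_const [intro]: "smooth_on U (\<lambda>x. c)"
  by (simp add: smooth_on_def Ck_on_const)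

lemma smooth_on_coord [intro]: "smooth_on U (\<lambda>x. x $ j)"
  by (simp add: smooth_on_def Ck_on_coord)

lemma smooth_on_add: "open U \<Longrightarrow> smooth_on U f \<Longrightarrow> smooth_on U g \<Longrightarrow> smooth_on U (\<lambda>x. f x + g x)"
  by (simp add: smooth_on_def Ck_on_add)

lemma smooth_on_mult: "open U \<Longrightarrow> smooth_on U f \<Longrightarrow> smooth_on U g \<Longrightarrow> smooth_on U (\<lambda>x. f x * g x)"
  by (simp add: smooth_on_def Ck_on_mult)

lemma smooth_on_minus: "open U \<Longrightarrow> smooth_on U f \<Longrightarrow> smooth_on U (\<lambda>x. - f x)"
  using smooth_on_mult[of U "\<lambda>x. -1" f] by (simp add: smooth_on_const)

lemma smooth_on_diff: "open U \<Longrightarrow> smooth_on U f \<Longrightarrow> smooth_on U g \<Longrightarrow> smooth_on U (\<lambda>x. f x - g x)"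
  using smooth_on_add[of U f "\<lambda>x. - g x"] smooth_on_minus[of U g] by simp

lemma smooth_on_compose:
  assumes "open U" "smooth_on U f" "\<And>x. x \<in> U \<Longrightarrow> f x \<in> V"
    and "\<And>n t. t \<in> V \<Longrightarrow> (D n has_real_derivative D (Suc n) t) (at t)"
  shows "smooth_on U (\<lambda>x. D n (f x))"
  unfolding smooth_on_def
  by (rule allI, rule Ck_on_compose[of U V D f]) (use assms in \<open>auto simp: smooth_on_def\<close>)

lemma smooth_on_exp: "open U \<Longrightarrow> smooth_on U f \<Longrightarrow> smooth_on U (\<lambda>x. exp (f x))"
  by (rule smooth_on_compose[of U f UNIV "\<lambda>n. exp" 0]) (auto intro: DERIV_exp)

lemma smooth_on_cos:
  assumes "open U" "smooth_on U f"
  shows "smooth_on U (\<lambda>x. cos (f x))"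
proof -
  \<comment> \<open>Each differentiation advances the phase of the cosine by a quarter turn, which
    gives all derivatives by one formula.\<close>
  have "((\<lambda>t. cos (t + real n * (pi / 2))) has_real_derivative cos (t + real (Suc n) * (pi / 2))) (at t)"
    for n t
  proof -
    have "cos (t + real (Suc n) * (pi / 2)) = cos (t + real n * (pi / 2) + pi / 2)"
      by (simp add: algebra_simps add_divide_distrib)
    also have "\<dots> = - sin (t + real n * (pi / 2))" by (simp add: cos_add)
    finally show ?thesis by (auto intro!: derivative_eq_intros)
  qed
  then show ?thesis
    using smooth_on_compose[of U f UNIV "\<lambda>n t. cos (t + real n * (pi / 2))" 0, OF assms]
    by simp
qed

lemma smooth_on_inverse:
  assumes "open U" "smooth_on U f" "\<And>x. x \<in> U \<Longrightarrow> f x \<noteq> 0"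
  shows "smooth_on U (\<lambda>x. inverse (f x))"
proof -
  define D where "D n t = (- 1) ^ n * fact n * inverse t ^ Suc n" for n and t :: real
  have "(D n has_real_derivative D (Suc n) t) (at t)" if "t \<in> - {0}" for n t
  proof -
    have "t \<noteq> 0" using that by simp
    from DERIV_cmult[OF DERIV_power_Suc[OF DERIV_inverse[OF this]], of "(- 1) ^ n * fact n" n]
    show ?thesis unfolding D_def by (rule DERIV_cong) (simp add: algebra_simps)
  qed
  from smooth_on_compose[of U f "- {0}" D 0, OF assms(1,2) _ this] assms(3)
  show ?thesis by (simp add: D_def)
qed

text \<open>Needed for the cutoff, which is known only as an antiderivative of an explicit bump
  function.\<close>

lemma smooth_on_antiderivative:
  assumes "open U" "smooth_on U f" "\<And>x. x \<in> U \<Longrightarrow> (g has_real_derivative g' (f x)) (at (f x))"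
    and "smooth_on U (\<lambda>x. g' (f x))"
  shows "smooth_on U (\<lambda>x. g (f x))"
proof (rule smooth_onI[where g = "\<lambda>i x. g' (f x) * partial_deriv i f x"])
  show "smooth_on U (\<lambda>x. g' (f x) * partial_deriv i f x)" for i
    by (intro smooth_on_mult smooth_on_partial_deriv assms)
qed (use assms in \<open>auto intro: differentiable_compose_real smooth_on_imp_differentiable
    simp: partial_deriv_compose smooth_on_imp_differentiable\<close>)

section \<open>Smooth cutoff functions\<close>

text \<open>The recursion is read off from the derivative of P(1/t) e^(-1/t), which is t^(-2) (P -
  P')(1/t) e^(-1/t); the polynomial \<open>[:0, 0, 1:]\<close> is u^2 at u = 1/t.\<close>

fun flat_poly :: "nat \<Rightarrow> real poly" where
  "flat_poly 0 = 1"
| "flat_poly (Suc n) = [:0, 0, 1:] * (flat_poly n - pderiv (flat_poly n))"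

text \<open>\<open>flat n\<close> is the \<open>n\<close>-th derivative of the function equal to $e^{-1/t}$ for $t > 0$ and to $0$ for $t \le 0$.\<close>

definition flat :: "nat \<Rightarrow> real \<Rightarrow> real" where
  "flat n t = (if t > 0 then poly (flat_poly n) (inverse t) * exp (- inverse t) else 0)"

lemma tendsto_poly_times_exp_minus:
  "((\<lambda>u. poly p u * exp (- u)) \<longlongrightarrow> (0::real)) at_top"
proof -
  have "((\<lambda>u. \<Sum>i\<le>degree p. coeff p i * (u ^ i / exp u)) \<longlongrightarrow> (\<Sum>i\<le>degree p. coeff p i * 0)) at_top"
    by (intro tendsto_sum tendsto_mult tendsto_const tendsto_power_div_exp_0)
  moreover have "(\<Sum>i\<le>degree p. coeff p i * (u ^ i / exp u)) = poly p u * exp (- u)" for u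
    by (simp add: poly_altdef sum_distrib_right exp_minus divide_simps)
  ultimately show ?thesis by simp
qed

lemma flat_has_derivative: "(flat n has_real_derivative flat (Suc n) t) (at t)"
proof -
  consider "t > 0" | "t < 0" | "t = 0" by linarith
  then show ?thesis
  proof cases
    case 1
    have "((\<lambda>t. poly (flat_poly n) (inverse t) * exp (- inverse t)) has_real_derivative
        flat (Suc n) t) (at t)"
      using 1
      by (auto intro!: derivative_eq_intros simp: flat_def field_simps power2_eq_square)
    then show ?thesis
      by (rule has_field_derivative_transform_within_open[where S = "{0<..}"]) (use 1 in \<open>auto simp: flat_def\<close>)
  next
    case 2
    have "((\<lambda>t. 0) has_real_derivative flat (Suc n) t) (at t)" using 2 by (simp add: flat_def)
    then show ?thesis
      by (rule has_field_derivative_transform_within_open[where S = "{..<0}"]) (use 2 in \<open>auto simp: flat_def\<close>)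
  next
    case 3
    \<comment> \<open>For t > 0 the difference quotient at 0 is \<open>flat n t\<close> / t, which
      is u P(u) e^(-u) at u = 1/t. Dividing by t supplies the extra factor
      \<open>[:0, 1:]\<close>.\<close>
    have "((\<lambda>u. poly ([:0, 1:] * flat_poly n) u * exp (- u)) \<longlongrightarrow> (0::real)) at_top"
      by (rule tendsto_poly_times_exp_minus)
    then have "((\<lambda>t. poly ([:0, 1:] * flat_poly n) (inverse t) * exp (- inverse t)) \<longlongrightarrow> (0::real)) (at_right 0)"
      by (rule filterlim_compose) (rule filterlim_inverse_at_top_right)
    then have r: "((\<lambda>t. (flat n t - flat n 0) / (t - 0)) \<longlongrightarrow> 0) (at_right 0)"
      by (rule Lim_transform_eventually)
        (auto simp: flat_def field_simps eventually_at_right_less intro!: eventually_mono[OF eventually_at_right_less])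
    have "((\<lambda>t. (flat n t - flat n 0) / (t - 0)) \<longlongrightarrow> 0) (at_left 0)"
      by (rule Lim_transform_eventually[OF tendsto_const])
        (auto simp: flat_def eventually_at_filter)
    with r have "((\<lambda>t. (flat n t - flat n 0) / (t - 0)) \<longlongrightarrow> 0) (at 0)"
      by (simp add: filterlim_split_at)
    then show ?thesis using 3 by (simp add: has_field_derivative_iff flat_def)
  qed
qed

lemma smooth_on_flat: "open U \<Longrightarrow> smooth_on U f \<Longrightarrow> smooth_on U (\<lambda>x. flat n (f x))"
  by (rule smooth_on_compose[of U f UNIV flat]) (auto intro: flat_has_derivative)

lemma flat_nonneg: "flat 0 t \<ge> 0" and flat_pos: "t > 0 \<Longrightarrow> flat 0 t > 0"
  by (auto simp: flat_def)

text \<open>Z falls from 1 to 0 as a normalised antiderivative of minus the bump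
  \<open>flat 0 t * flat 0 (1 - t)\<close>, which lives on (0, 1). Smoothness is recorded for
  compositions, the form in which cutoffs of the plane use it; \<open>Z1\<close> and
  \<open>Z2\<close> are named because the weight in J is made of them.\<close>

lemma smooth_step_exists:
  "\<exists>Z Z1 Z2 :: real \<Rightarrow> real. (\<forall>t. (Z has_real_derivative Z1 t) (at t)) \<and>
     (\<forall>t. (Z1 has_real_derivative Z2 t) (at t)) \<and> continuous_on UNIV Z2 \<and>
     (\<forall>t\<le>0. Z t = 1 \<and> Z1 t = 0 \<and> Z2 t = 0) \<and> (\<forall>t\<ge>1. Z t = 0 \<and> Z1 t = 0 \<and> Z2 t = 0) \<and>
     antimono Z \<and>
     (\<forall>(U :: (real ^ 'n::finite) set) f. open U \<longrightarrow> smooth_on U f \<longrightarrow> smooth_on U (\<lambda>x. Z (f x)))"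
proof -
  define \<beta> where "\<beta> t = flat 0 t * flat 0 (1 - t)" for t
  define \<beta>' where "\<beta>' t = flat 1 t * flat 0 (1 - t) - flat 0 t * flat 1 (1 - t)" for t
  have flatD: "((\<lambda>t. flat n (1 - t)) has_real_derivative - flat (Suc n) (1 - t)) (at t)" for n t
  proof -
    have "((-) 1 has_real_derivative - 1) (at t)" by (auto intro!: derivative_eq_intros)
    from DERIV_chain'[OF this flat_has_derivative] show ?thesis by simp
  qed
  have \<beta>D: "(\<beta> has_real_derivative \<beta>' t) (at t)" for t
    unfolding \<beta>_def \<beta>'_def
    by (auto intro!: derivative_eq_intros flat_has_derivative flatD)
  have contf: "continuous_on UNIV (flat n)" for n
    by (intro continuous_at_imp_continuous_on ballI) (rule DERIV_isCont[OF flat_has_derivative])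
  have cont\<beta>': "continuous_on UNIV \<beta>'"
    unfolding \<beta>'_def
    by (intro continuous_intros continuous_on_compose2[OF contf]) auto
  have \<beta>_nonneg: "\<beta> t \<ge> 0" for t by (simp add: \<beta>_def flat_nonneg)
  have \<beta>_pos: "\<beta> t > 0" if "0 < t" "t < 1" for t using that by (simp add: \<beta>_def flat_pos)
  have \<beta>_0: "\<beta> t = 0" "\<beta>' t = 0" if "t \<le> 0 \<or> t \<ge> 1" for t
    using that by (auto simp: \<beta>_def \<beta>'_def flat_def)
  obtain F where F: "\<And>t. (F has_real_derivative \<beta> t) (at t)"
    using einterval_antiderivative[of "-\<infinity>" "\<infinity>" \<beta>] DERIV_isCont[OF \<beta>D]
    by (auto simp: has_real_derivative_iff_has_vector_derivative)
  have monoF: "F s \<le> F t" if "s \<le> t" for s t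
  proof (rule DERIV_nonneg_imp_nondecreasing[OF that])
    fix x show "\<exists>y. (F has_real_derivative y) (at x) \<and> 0 \<le> y"
      by (rule exI[of _ "\<beta> x"]) (simp add: F \<beta>_nonneg)
  qed
  have contF: "continuous_on A F" for A
    by (intro continuous_at_imp_continuous_on ballI) (rule DERIV_isCont[OF F])
  have F01: "F 0 < F 1"
  proof (rule DERIV_pos_imp_increasing_open[of 0 1 F])
    fix x :: real assume "0 < x" "x < 1"
    then show "\<exists>y. (F has_real_derivative y) (at x) \<and> 0 < y"
      by (intro exI[of _ "\<beta> x"]) (simp add: F \<beta>_pos)
  qed (simp_all add: contF)
  have F0': "(F has_real_derivative 0) (at t)" if "t \<le> 0 \<or> t \<ge> 1" for t
    using F[of t] \<beta>_0(1)[OF that] by simp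
  have F0: "F t = F 0" if "t \<le> 0" for t
  proof (cases "t = 0")
    case False
    then have "F 0 = F t"
      using that by (intro DERIV_isconst_end[of t 0 F] contF F0') auto
    then show ?thesis by simp
  qed simp
  have F1: "F t = F 1" if "t \<ge> 1" for t
  proof (cases "t = 1")
    case False
    then show ?thesis
      using that by (intro DERIV_isconst_end[of 1 t F] contF F0') auto
  qed simp
  define c where "c = F 1 - F 0"
  have c: "c > 0" using F01 by (simp add: c_def)
  define Z Z1 Z2 where "Z t = (F 1 - F t) / c" and "Z1 t = - \<beta> t / c" and "Z2 t = - \<beta>' t / c" for t
  have Z: "(Z has_real_derivative Z1 t) (at t)" for t
    unfolding Z_def Z1_def
    by (rule DERIV_cong[OF DERIV_cdivide[OF DERIV_diff[OF DERIV_const F]]]) simp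
  have Z1: "(Z1 has_real_derivative Z2 t) (at t)" for t
    unfolding Z1_def Z2_def by (intro DERIV_cdivide DERIV_minus \<beta>D)
  have "continuous_on UNIV Z2" unfolding Z2_def using cont\<beta>' c by (intro continuous_intros) auto
  moreover have "Z t = 1 \<and> Z1 t = 0 \<and> Z2 t = 0" if "t \<le> 0" for t
    using that c F0[OF that] \<beta>_0[of t] by (simp add: Z_def Z1_def Z2_def c_def)
  moreover have "Z t = 0 \<and> Z1 t = 0 \<and> Z2 t = 0" if "t \<ge> 1" for t
    using that F1[OF that] \<beta>_0[of t] by (simp add: Z_def Z1_def Z2_def)
  moreover have "antimono Z"
    using c monoF by (auto simp: antimono_def Z_def divide_right_mono)
  moreover have "smooth_on U (\<lambda>x. Z (f x))"
    if "open U" "smooth_on U f" for U :: "(real ^ 'n) set" and f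
  proof (rule smooth_on_antiderivative[OF that, where g' = Z1])
    have "smooth_on U (\<lambda>x. (- 1 / c) * (flat 0 (f x) * flat 0 (1 - f x)))"
      using that by (intro smooth_on_mult smooth_on_const smooth_on_flat smooth_on_diff)
    then show "smooth_on U (\<lambda>x. Z1 (f x))" by (simp add: Z1_def \<beta>_def)
  qed (rule Z)
  ultimately show ?thesis
    using Z Z1 by (intro exI[of _ Z] exI[of _ Z1] exI[of _ Z2] conjI allI impI) simp_all
qed

section \<open>The equation in double divergence form\<close>

text \<open>Any compact set outside which the function vanishes may replace the closed support, so
  supports never have to be computed.\<close>

lemma test_function_iff:
  "test_function U \<phi> \<longleftrightarrow>
     smooth_on UNIV \<phi> \<and> (\<exists>K. compact K \<and> K \<subseteq> U \<and> (\<forall>x. x \<notin> K \<longrightarrow> \<phi> x = 0))"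
proof
  assume "test_function U \<phi>"
  moreover have "\<forall>x. x \<notin> closure {x. \<phi> x \<noteq> 0} \<longrightarrow> \<phi> x = 0"
    using closure_subset[of "{x. \<phi> x \<noteq> 0}"] by auto
  ultimately show "smooth_on UNIV \<phi> \<and> (\<exists>K. compact K \<and> K \<subseteq> U \<and> (\<forall>x. x \<notin> K \<longrightarrow> \<phi> x = 0))"
    unfolding test_function_def smooth_on_def by blast
next
  assume *: "smooth_on UNIV \<phi> \<and> (\<exists>K. compact K \<and> K \<subseteq> U \<and> (\<forall>x. x \<notin> K \<longrightarrow> \<phi> x = 0))"
  then obtain K where K: "compact K" "K \<subseteq> U" "\<forall>x. x \<notin> K \<longrightarrow> \<phi> x = 0" by blast
  then have "closure {x. \<phi> x \<noteq> 0} \<subseteq> K"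
    by (intro closure_minimal compact_imp_closed) auto
  with * K show "test_function U \<phi>"
    using compact_Int_closed[of K "closure {x. \<phi> x \<noteq> 0}"]
    by (auto simp: test_function_def smooth_on_def Int_absorb1)
qed

lemma test_function_partial_deriv:
  assumes "test_function U \<phi>"
  shows "test_function U (partial_deriv i \<phi>)"
proof -
  from assms obtain K where K: "smooth_on UNIV \<phi>" "compact K" "K \<subseteq> U"
    "\<And>x. x \<notin> K \<Longrightarrow> \<phi> x = 0" by (auto simp: test_function_iff)
  have "partial_deriv i \<phi> x = 0" if "x \<notin> K" for x
    using partial_deriv_cong[of "- K" x \<phi> "\<lambda>x. 0"] K that
    by (simp add: compact_imp_closed open_Compl partial_deriv_def)
  with K show ?thesis
    using smooth_on_partial_deriv[OF K(1), of i] by (auto simp: test_function_iff)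
qed

lemma test_function_mult:
  assumes "test_function U \<phi>" "smooth_on UNIV b"
  shows "test_function U (\<lambda>x. b x * \<phi> x)"
proof -
  from assms(1) obtain K where K: "smooth_on UNIV \<phi>" "compact K" "K \<subseteq> U"
    "\<And>x. x \<notin> K \<Longrightarrow> \<phi> x = 0" by (auto simp: test_function_iff)
  then show ?thesis
    using smooth_on_mult[OF open_UNIV assms(2) K(1)] by (auto simp: test_function_iff)
qed

lemma integrable_bounded_mult:
  fixes f g :: "'a \<Rightarrow> real"
  assumes "integrable M f" "g \<in> borel_measurable M" "\<And>x. \<bar>g x\<bar> \<le> B"
  shows "integrable M (\<lambda>x. f x * g x)"
proof (rule Bochner_Integration.integrable_bound[OF integrable_mult_right[OF assms(1), of B]])
  show "(\<lambda>x. f x * g x) \<in> borel_measurable M"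
    by (rule borel_measurable_times[OF borel_measurable_integrable[OF assms(1)] assms(2)])
  have "\<bar>f x * g x\<bar> \<le> \<bar>B * f x\<bar>" for x
    using mult_left_mono[OF assms(3)[of x] abs_ge_zero[of "f x"]] assms(3)[of x]
    by (simp add: abs_mult mult.commute)
  then show "AE x in M. norm (f x * g x) \<le> norm (B * f x)" by simp
qed

lemma integrable_L1_loc_mult:
  assumes "L1_loc U f" "compact K" "K \<subseteq> U" "g \<in> borel_measurable lebesgue"
    and "\<And>x. \<bar>g x\<bar> \<le> B" "\<And>x. x \<notin> K \<Longrightarrow> g x = 0"
  shows "integrable lebesgue (\<lambda>x. f x * g x)"
proof -
  have K: "K \<in> sets lebesgue" using assms(2) by (simp add: borel_compact)
  have "integrable (lebesgue_on K) f" using assms(1-3) by (simp add: L1_loc_def)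
  then have "integrable lebesgue (\<lambda>x. indicator K x *\<^sub>R f x)"
    using K by (subst (asm) integrable_restrict_space) auto
  then have "integrable lebesgue (\<lambda>x. (indicator K x *\<^sub>R f x) * g x)"
    by (rule integrable_bounded_mult[OF _ assms(4,5)])
  moreover have "(\<lambda>x. (indicator K x *\<^sub>R f x) * g x) = (\<lambda>x. f x * g x)"
  proof
    show "(indicator K x *\<^sub>R f x) * g x = f x * g x" for x
      using assms(6)[of x] by (cases "x \<in> K") auto
  qed
  ultimately show ?thesis by (simp only:)
qed

lemma test_function_bounded:
  assumes "test_function U \<phi>"
  obtains K B where "compact K" "K \<subseteq> U" "\<And>x. x \<notin> K \<Longrightarrow> \<phi> x = 0" "\<And>x. \<bar>\<phi> x\<bar> \<le> B"
    "\<phi> \<in> borel_measurable lebesgue"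
proof -
  from assms obtain K where K: "smooth_on UNIV \<phi>" "compact K" "K \<subseteq> U"
    "\<And>x. x \<notin> K \<Longrightarrow> \<phi> x = 0" by (auto simp: test_function_iff)
  have c: "continuous_on UNIV \<phi>" using K by (simp add: smooth_on_imp_continuous_on)
  then have "bounded (\<phi> ` K)"
    using K by (meson compact_continuous_image compact_imp_bounded continuous_on_subset subset_UNIV)
  then obtain B where B: "\<And>x. x \<in> K \<Longrightarrow> \<bar>\<phi> x\<bar> \<le> B" by (auto simp: bounded_iff)
  show ?thesis
  proof (rule that[OF K(2-4)])
    show "\<bar>\<phi> x\<bar> \<le> max B 0" for x using B[of x] K(4)[of x] by (cases "x \<in> K") auto
    show "\<phi> \<in> borel_measurable lebesgue"
      using borel_measurable_continuous_onI[OF c] by (simp add: measurable_completion)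
  qed
qed

lemma integrable_L1_loc_test:
  assumes "L1_loc U f" "test_function U \<phi>"
  shows "integrable lebesgue (\<lambda>x. f x * \<phi> x)"
  using assms(2) by (rule test_function_bounded) (rule integrable_L1_loc_mult[OF assms(1)])

lemma integral_lebesgue_on_vanishing:
  fixes f :: "'a::euclidean_space \<Rightarrow> real"
  assumes "U \<in> sets lebesgue" "\<And>x. x \<notin> U \<Longrightarrow> f x = 0"
  shows "(\<integral>x. f x \<partial>lebesgue_on U) = (\<integral>x. f x \<partial>lebesgue)"
proof -
  have "(\<lambda>x. indicator U x *\<^sub>R f x) = f"
  proof
    show "indicator U x *\<^sub>R f x = f x" for x using assms(2)[of x] by (cases "x \<in> U") auto
  qed
  then show ?thesis using assms(1) integral_restrict_space[of U lebesgue f] by simp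
qed

lemma weak_partial_deriv_lebesgue:
  assumes "weak_partial_deriv U i f g" "open U" "test_function U \<phi>"
  shows "(\<integral>x. f x * partial_deriv i \<phi> x \<partial>lebesgue) = - (\<integral>x. g x * \<phi> x \<partial>lebesgue)"
proof -
  have z: "\<psi> x = 0" if "test_function U \<psi>" "x \<notin> U" for \<psi> x
    using that by (auto simp: test_function_iff)
  have U: "U \<in> sets lebesgue" using assms(2) by (simp add: borel_open)
  have "(\<integral>x. f x * partial_deriv i \<phi> x \<partial>lebesgue_on U) = (\<integral>x. f x * partial_deriv i \<phi> x \<partial>lebesgue)"
    by (rule integral_lebesgue_on_vanishing[OF U])
      (simp add: z[OF test_function_partial_deriv[OF assms(3)]])
  moreover have "(\<integral>x. g x * \<phi> x \<partial>lebesgue_on U) = (\<integral>x. g x * \<phi> x \<partial>lebesgue)"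
    by (rule integral_lebesgue_on_vanishing[OF U]) (simp add: z[OF assms(3)])
  ultimately show ?thesis using assms by (simp add: weak_partial_deriv_def)
qed

lemma weak_second_deriv:
  assumes "W22_loc_with U f G H" "open U" "test_function U \<phi>"
  shows "(\<integral>x. f x * partial_deriv i (partial_deriv j \<phi>) x \<partial>lebesgue)
    = (\<integral>x. H x $ i $ j * \<phi> x \<partial>lebesgue)"
proof -
  have "weak_partial_deriv U i f (\<lambda>x. G x $ i)"
    and "weak_partial_deriv U j (\<lambda>x. G x $ i) (\<lambda>x. H x $ i $ j)"
    using assms(1) by (auto simp: W22_loc_with_def)
  from weak_partial_deriv_lebesgue[OF this(1) assms(2) test_function_partial_deriv[OF assms(3)]]
    weak_partial_deriv_lebesgue[OF this(2) assms(2,3)]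
  show ?thesis by simp
qed

section \<open>The adjoint operator and integration by parts\<close>

definition perp :: "real ^ 2 \<Rightarrow> 2 \<Rightarrow> real" where
  "perp x i = (if i = 1 then - x $ 2 else x $ 1)"

text \<open>The polynomial matrix $|x|^2 a(x) = x \otimes x + (1 + \varepsilon)\, x^\perp \otimes x^\perp$.\<close>

definition coeff_poly :: "real \<Rightarrow> 2 \<Rightarrow> 2 \<Rightarrow> real ^ 2 \<Rightarrow> real" where
  "coeff_poly \<epsilon> i j x = x $ i * x $ j + (1 + \<epsilon>) * (perp x i * perp x j)"

text \<open>The formal adjoint of |x|^2 a_ij d_ij. Because \<open>coeff_poly\<close> is smooth, it
  can be absorbed into the test function before integrating by parts; the matrix a itself has no
  limit at the origin.\<close>

definition double_div :: "real \<Rightarrow> (real ^ 2 \<Rightarrow> real) \<Rightarrow> real ^ 2 \<Rightarrow> real" where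
  "double_div \<epsilon> \<psi> x =
     (\<Sum>i\<in>UNIV. \<Sum>j\<in>UNIV. partial_deriv i (partial_deriv j (\<lambda>y. coeff_poly \<epsilon> i j y * \<psi> y)) x)"

lemma norm_power2_vec2: "(norm (x :: real ^ 2))\<^sup>2 = (x $ 1)\<^sup>2 + (x $ 2)\<^sup>2"
  unfolding power2_norm_eq_inner by (simp add: inner_vec_def sum_2 power2_eq_square)

lemma coeff_poly_eq: "coeff_poly \<epsilon> i j x = (norm x)\<^sup>2 * coeff_matrix \<epsilon> x $ i $ j"
proof (cases "x = 0")
  case True
  then show ?thesis by (simp add: coeff_poly_def perp_def)
next
  case False
  then have "(norm x)\<^sup>2 \<noteq> 0" by simp
  then show ?thesis
    using exhaust_2[of i] exhaust_2[of j]
    by (auto simp: coeff_poly_def coeff_matrix_def perp_def norm_power2_vec2 divide_simps)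
      (auto simp: algebra_simps power2_eq_square)
qed

lemma smooth_on_perp: "smooth_on U (\<lambda>x. perp x i)" if "open U"
  unfolding perp_def using that by (cases "i = 1") (auto intro!: smooth_on_minus)

lemma smooth_on_coeff_poly: "smooth_on UNIV (coeff_poly \<epsilon> i j)"
proof -
  have "smooth_on UNIV (\<lambda>x. x $ i * x $ j + (1 + \<epsilon>) * (perp x i * perp x j))"
    by (intro smooth_on_add smooth_on_mult smooth_on_perp smooth_on_coord smooth_on_const open_UNIV)
  then show ?thesis by (simp add: coeff_poly_def[abs_def])
qed

text \<open>Local integrability gives measurability of v only on compact subsets of the disc, so the
  disc is exhausted by closed ones.\<close>

lemma positivity_set_measurable:
  assumes "L1_loc (ball 0 1) v"
  shows "positivity_set v \<in> sets lebesgue"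
proof -
  have "{x \<in> cball 0 (1 - inverse (real (Suc n))). 0 < v x} \<in> sets lebesgue" for n
  proof -
    let ?K = "cball (0 :: real ^ 2) (1 - inverse (real (Suc n)))"
    have "inverse (real (Suc n)) > 0" by simp
    then have "?K \<subseteq> ball 0 1" unfolding subset_iff mem_cball_0 mem_ball_0
      by (intro allI impI) linarith
    then have "integrable (lebesgue_on ?K) v"
      using assms compact_cball unfolding L1_loc_def by blast
    then have "v \<in> borel_measurable (lebesgue_on ?K)" by (rule borel_measurable_integrable)
    then have "{x \<in> space (lebesgue_on ?K). 0 < v x} \<in> sets (lebesgue_on ?K)"
      by (rule borel_measurable_less[OF borel_measurable_const])
    then show ?thesis by (auto simp: sets_restrict_space_iff)
  qed
  then have "(\<Union>n. {x \<in> cball 0 (1 - inverse (real (Suc n))). 0 < v x}) \<in> sets lebesgue"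
    by blast
  moreover have "positivity_set v = (\<Union>n. {x \<in> cball 0 (1 - inverse (real (Suc n))). 0 < v x})"
  proof (intro set_eqI iffI)
    fix x assume "x \<in> positivity_set v"
    then have x: "norm x < 1" "0 < v x" by (auto simp: positivity_set_def)
    then obtain n where "inverse (real (Suc n)) < 1 - norm x"
      using reals_Archimedean[of "1 - norm x"] by auto
    then have "norm x \<le> 1 - inverse (real (Suc n))" by simp
    with x show "x \<in> (\<Union>n. {x \<in> cball 0 (1 - inverse (real (Suc n))). 0 < v x})" by auto
  next
    fix x assume "x \<in> (\<Union>n. {x \<in> cball 0 (1 - inverse (real (Suc n))). 0 < v x})"
    then obtain n where "norm x \<le> 1 - inverse (real (Suc n))" "0 < v x" by auto
    moreover have "inverse (real (Suc n)) > 0" by simp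
    ultimately have "norm x < 1" by linarith
    then show "x \<in> positivity_set v" using \<open>0 < v x\<close> by (simp add: positivity_set_def)
  qed
  ultimately show ?thesis by simp
qed

text \<open>Two integrations by parts with the test functions \<open>coeff_poly * \<psi>\<close>
  bring back the weak Hessian; \<open>coeff_poly_eq\<close> then exposes the equation, multiplied by
  |x|^2 \<psi>.\<close>

lemma strong_solution_double_div:
  assumes "strong_solution (coeff_matrix \<epsilon>) v" "test_function (ball 0 1) \<psi>"
  shows "(\<integral>x. v x * double_div \<epsilon> \<psi> x \<partial>lebesgue)
    = (\<integral>x. indicator (positivity_set v) x * ((norm x)\<^sup>2 * \<psi> x) \<partial>lebesgue)"
proof -
  obtain G H where W: "W22_loc_with (ball 0 1) v G H"
    and ae: "AE x in lebesgue_on (ball 0 1).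
        (\<Sum>i\<in>UNIV. \<Sum>j\<in>UNIV. coeff_matrix \<epsilon> x $ i $ j * H x $ i $ j) = indicator (positivity_set v) x"
    using assms(1) by (auto simp: strong_solution_def)
  have T: "test_function (ball 0 1) (\<lambda>y. coeff_poly \<epsilon> i j y * \<psi> y)" for i j
    by (intro test_function_mult assms smooth_on_coeff_poly)
  have Lv: "L1_loc (ball 0 1) v" and LH: "L1_loc (ball 0 1) (\<lambda>x. H x $ i $ j)" for i j
    using W by (auto simp: W22_loc_with_def weak_partial_deriv_def)
  have iv: "integrable lebesgue (\<lambda>x. v x * partial_deriv i (partial_deriv j (\<lambda>y. coeff_poly \<epsilon> i j y * \<psi> y)) x)"
    for i j by (intro integrable_L1_loc_test[OF Lv] test_function_partial_deriv T)
  have iH: "integrable lebesgue (\<lambda>x. H x $ i $ j * (coeff_poly \<epsilon> i j x * \<psi> x))" for i j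
    by (intro integrable_L1_loc_test[OF LH] T)
  have "(\<integral>x. v x * double_div \<epsilon> \<psi> x \<partial>lebesgue) =
      (\<Sum>i\<in>UNIV. \<Sum>j\<in>UNIV. \<integral>x. v x * partial_deriv i (partial_deriv j (\<lambda>y. coeff_poly \<epsilon> i j y * \<psi> y)) x \<partial>lebesgue)"
    unfolding double_div_def sum_distrib_left
    by (simp only: Bochner_Integration.integral_sum Bochner_Integration.integrable_sum iv)
  also have "\<dots> = (\<Sum>i\<in>UNIV. \<Sum>j\<in>UNIV. \<integral>x. H x $ i $ j * (coeff_poly \<epsilon> i j x * \<psi> x) \<partial>lebesgue)"
    by (simp only: weak_second_deriv[OF W open_ball T])
  also have "\<dots> = (\<integral>x. (\<Sum>i\<in>UNIV. \<Sum>j\<in>UNIV. H x $ i $ j * (coeff_poly \<epsilon> i j x * \<psi> x)) \<partial>lebesgue)"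
    by (simp only: Bochner_Integration.integral_sum Bochner_Integration.integrable_sum iH)
  also have "\<dots> = (\<integral>x. indicator (positivity_set v) x * ((norm x)\<^sup>2 * \<psi> x) \<partial>lebesgue)"
  proof (rule integral_cong_AE)
    show "(\<lambda>x. \<Sum>i\<in>UNIV. \<Sum>j\<in>UNIV. H x $ i $ j * (coeff_poly \<epsilon> i j x * \<psi> x)) \<in> borel_measurable lebesgue"
      by (intro borel_measurable_sum borel_measurable_integrable iH)
    have "(\<lambda>x::real^2. (norm x)\<^sup>2) \<in> borel_measurable lebesgue" "\<psi> \<in> borel_measurable lebesgue"
      using assms(2) by (auto elim!: test_function_bounded intro: measurable_completion)
    then show "(\<lambda>x. indicator (positivity_set v) x * ((norm x)\<^sup>2 * \<psi> x)) \<in> borel_measurable lebesgue"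
      using positivity_set_measurable[OF Lv] by (intro borel_measurable_times borel_measurable_indicator)
    have "ball 0 1 \<inter> space lebesgue \<in> sets (lebesgue :: (real ^ 2) measure)" by simp
    from ae[unfolded AE_restrict_space_iff[OF this]]
    show "AE x in lebesgue. (\<Sum>i\<in>UNIV. \<Sum>j\<in>UNIV. H x $ i $ j * (coeff_poly \<epsilon> i j x * \<psi> x))
        = indicator (positivity_set v) x * ((norm x)\<^sup>2 * \<psi> x)"
    proof eventually_elim
      case (elim x)
      have "(\<Sum>i\<in>UNIV. \<Sum>j\<in>UNIV. H x $ i $ j * (coeff_poly \<epsilon> i j x * \<psi> x))
          = (\<Sum>i\<in>UNIV. \<Sum>j\<in>UNIV. coeff_matrix \<epsilon> x $ i $ j * H x $ i $ j) * ((norm x)\<^sup>2 * \<psi> x)"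
        by (simp add: coeff_poly_eq sum_distrib_left sum_distrib_right mult_ac)
      moreover have "\<psi> x = 0" if "x \<notin> ball 0 1"
        using assms(2) that by (auto simp: test_function_iff)
      ultimately show ?case using elim by (cases "x \<in> ball 0 1") auto
    qed
  qed
  finally show ?thesis .
qed

section \<open>Logarithmic polar coordinates\<close>

definition log_norm :: "real ^ 2 \<Rightarrow> real" where
  "log_norm x = ln (norm x)"

text \<open>The plane as complex numbers, turned by w. In the application w is a unit number for
  which the tangent half-plane of the positivity set becomes Re > 0.\<close>

definition rot_complex :: "complex \<Rightarrow> real ^ 2 \<Rightarrow> complex" where
  "rot_complex w x = w * Complex (x $ 1) (x $ 2)"

text \<open>The principal argument after the rotation. Its branch cut is the ray opposite to the
  axis of the half-plane Re > 0, far from where v is positive near the origin.\<close>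

definition angle :: "complex \<Rightarrow> real ^ 2 \<Rightarrow> real" where
  "angle w x = Im (Ln (rot_complex w x))"

lemma norm_rot_complex:
  assumes "cmod w = 1"
  shows "cmod (rot_complex w x) = norm x"
proof -
  have "cmod (Complex (x $ 1) (x $ 2)) = norm x"
    by (simp add: cmod_def norm_vec_def L2_set_def sum_2)
  then show ?thesis using assms by (simp add: rot_complex_def norm_mult)
qed

lemma rot_complex_0 [simp]: "rot_complex w 0 = 0"
  by (simp add: rot_complex_def complex_eq_iff)

lemma rot_complex_eq_0_iff: "cmod w = 1 \<Longrightarrow> rot_complex w x = 0 \<longleftrightarrow> x = 0"
  using norm_rot_complex[of w x] by (metis norm_eq_zero)

lemma linear_rot_complex: "linear (rot_complex w)"
  by (rule linearI) (auto simp: rot_complex_def complex_eq_iff algebra_simps)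

lemma bounded_linear_rot_complex: "bounded_linear (rot_complex w)"
  by (simp add: linear_rot_complex linear_conv_bounded_linear[symmetric])

lemma continuous_on_rot_complex [continuous_intros]:
  "continuous_on S f \<Longrightarrow> continuous_on S (\<lambda>x. rot_complex w (f x))"
  using bounded_linear.continuous_on[OF bounded_linear_rot_complex] by blast

lemma log_norm_has_derivative:
  assumes "x \<noteq> 0"
  shows "(log_norm has_derivative (\<lambda>h. (x \<bullet> h) / (norm x)\<^sup>2)) (at x)"
proof -
  have "(ln has_derivative (*) (inverse (norm x))) (at (norm x))"
    using DERIV_ln[of "norm x"] assms by (simp add: has_field_derivative_def)
  from has_derivative_compose[OF has_derivative_norm[OF assms] this]
  have "((\<lambda>x. ln (norm x)) has_derivative (\<lambda>h. (sgn x \<bullet> h) * inverse (norm x))) (at x)"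
    by (simp add: mult.commute inner_commute)
  then show ?thesis
    by (simp add: log_norm_def[abs_def] sgn_div_norm power2_eq_square field_simps)
qed

text \<open>The differential of Ln z is h / z, and the factor w cancels from this quotient: the
  rotation moves the branch cut but leaves the gradient unchanged.\<close>

lemma angle_has_derivative:
  assumes "cmod w = 1" "rot_complex w x \<notin> \<real>\<^sub>\<le>\<^sub>0"
  shows "(angle w has_derivative (\<lambda>h. (x $ 1 * h $ 2 - x $ 2 * h $ 1) / (norm x)\<^sup>2)) (at x)"
proof -
  let ?z = "rot_complex w x"
  have nz: "?z \<noteq> 0" using assms(2) by auto
  have "(Ln has_derivative (\<lambda>h. inverse ?z * h)) (at ?z)"
    using has_field_derivative_Ln[OF assms(2)] by (simp add: has_field_derivative_def)
  with bounded_linear_imp_has_derivative[OF bounded_linear_rot_complex]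
  have "((\<lambda>x. Ln (rot_complex w x)) has_derivative (\<lambda>h. inverse ?z * rot_complex w h)) (at x)"
    by (rule has_derivative_compose)
  then have d: "((\<lambda>x. Im (Ln (rot_complex w x))) has_derivative (\<lambda>h. Im (inverse ?z * rot_complex w h))) (at x)"
    by (rule bounded_linear.has_derivative[OF bounded_linear_Im])
  have "Im (inverse ?z * rot_complex w h) = (x $ 1 * h $ 2 - x $ 2 * h $ 1) / (norm x)\<^sup>2" for h
  proof -
    have "inverse ?z * rot_complex w h = (w * Complex (h $ 1) (h $ 2)) / (w * Complex (x $ 1) (x $ 2))"
      by (simp add: rot_complex_def divide_inverse mult.commute)
    also have "\<dots> = Complex (h $ 1) (h $ 2) / Complex (x $ 1) (x $ 2)"
      using assms(1) by (intro mult_divide_mult_cancel_left) auto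
    finally show ?thesis by (simp add: Im_divide norm_power2_vec2 mult.commute)
  qed
  with d show ?thesis by (simp add: angle_def[abs_def])
qed

lemma partial_deriv_log_norm: "x \<noteq> 0 \<Longrightarrow> partial_deriv i log_norm x = x $ i / (norm x)\<^sup>2"
  using partial_deriv_eqI[OF log_norm_has_derivative] by (simp add: inner_axis)

lemma partial_deriv_angle:
  assumes "cmod w = 1" "rot_complex w x \<notin> \<real>\<^sub>\<le>\<^sub>0"
  shows "partial_deriv i (angle w) x = perp x i / (norm x)\<^sup>2"
  using partial_deriv_eqI[OF angle_has_derivative[OF assms]] exhaust_2[of i]
  by (auto simp: perp_def axis_def)

lemma differentiable_perp: "(\<lambda>x. perp x i) differentiable (at x)"
  by (rule smooth_on_imp_differentiable[OF smooth_on_perp[OF open_UNIV]]) simp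

lemma partial_deriv_perp:
  "partial_deriv j (\<lambda>x. perp x i) x = (if i = j then 0 else if i = 1 then - 1 else 1)"
proof -
  have 1: "(\<lambda>x. perp x 1) = (\<lambda>x. - x $ 2)" and 2: "(\<lambda>x. perp x 2) = (\<lambda>x. x $ 1)"
    by (auto simp: perp_def)
  have "partial_deriv j (\<lambda>x :: real ^ 2. - x $ 2) x = - partial_deriv j (\<lambda>x. x $ 2) x"
    using partial_deriv_mult[of "\<lambda>x. - 1" x "\<lambda>x. x $ 2" j, OF differentiable_const differentiable_coord]
    by (simp add: partial_deriv_def)
  then show ?thesis
    using exhaust_2[of i] exhaust_2[of j] by (auto simp: 1 2 partial_deriv_coord)
qed

text \<open>On the diagonal \<open>perp x i\<close> does not depend on x_i. Off the diagonal the
  product of the two \<open>perp\<close> entries is - x_1 x_2, which leaves the factor 1 - (1 +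
  \<epsilon>).\<close>

lemma partial_deriv_coeff_poly:
  "partial_deriv j (coeff_poly \<epsilon> i j) x = (if i = j then 2 else - \<epsilon>) * x $ i"
proof -
  have "coeff_poly \<epsilon> i j = (\<lambda>x. x $ i * x $ j + (1 + \<epsilon>) * (perp x i * perp x j))"
    by (auto simp: coeff_poly_def)
  moreover have "partial_deriv j (\<lambda>x. c) x = 0" for c by (simp add: partial_deriv_def)
  ultimately show ?thesis
    using exhaust_2[of i] exhaust_2[of j]
    by (auto simp: partial_deriv_add partial_deriv_mult differentiable_coord differentiable_perp
        differentiable_mult partial_deriv_coord partial_deriv_perp)
      (auto simp: perp_def algebra_simps)
qed

lemma open_slit: "open {x. rot_complex w x \<notin> \<real>\<^sub>\<le>\<^sub>0}"
proof -
  have "open (rot_complex w -` (- \<real>\<^sub>\<le>\<^sub>0))"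
    by (intro open_vimage continuous_intros) (simp add: open_Compl)
  then show ?thesis by (simp add: vimage_def)
qed

lemma smooth_on_inverse_norm_power2: "smooth_on (- {0 :: real ^ 2}) (\<lambda>x. inverse ((norm x)\<^sup>2))"
proof -
  have "smooth_on (- {0 :: real ^ 2}) (\<lambda>x. x $ 1 * x $ 1 + x $ 2 * x $ 2)"
    by (intro smooth_on_add smooth_on_mult smooth_on_coord) auto
  moreover have "(\<lambda>x :: real ^ 2. (norm x)\<^sup>2) = (\<lambda>x. x $ 1 * x $ 1 + x $ 2 * x $ 2)"
    by (rule ext) (simp only: norm_power2_vec2, simp only: power2_eq_square)
  ultimately have "smooth_on (- {0 :: real ^ 2}) (\<lambda>x. (norm x)\<^sup>2)" by simp
  then show ?thesis by (intro smooth_on_inverse) auto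
qed

lemma smooth_on_log_norm: "smooth_on (- {0}) log_norm"
proof (rule smooth_onI)
  show "smooth_on (- {0}) (\<lambda>x::real^2. x $ i * inverse ((norm x)\<^sup>2))" for i
    by (intro smooth_on_mult smooth_on_coord smooth_on_inverse_norm_power2) auto
qed (auto simp: partial_deriv_log_norm divide_inverse differentiable_def intro: log_norm_has_derivative)

lemma smooth_on_angle:
  assumes "cmod w = 1"
  shows "smooth_on {x. rot_complex w x \<notin> \<real>\<^sub>\<le>\<^sub>0} (angle w)"
proof (rule smooth_onI[OF open_slit])
  show "smooth_on {x. rot_complex w x \<notin> \<real>\<^sub>\<le>\<^sub>0} (\<lambda>x. perp x i * inverse ((norm x)\<^sup>2))" for i
  proof (intro smooth_on_mult open_slit smooth_on_perp)
    show "smooth_on {x. rot_complex w x \<notin> \<real>\<^sub>\<le>\<^sub>0} (\<lambda>x. inverse ((norm x)\<^sup>2))"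
      by (rule smooth_on_subset[OF smooth_on_inverse_norm_power2]) auto
  qed
qed (use assms in \<open>auto simp: partial_deriv_angle divide_inverse differentiable_def intro: angle_has_derivative\<close>)

definition separated :: "complex \<Rightarrow> (real \<Rightarrow> real) \<Rightarrow> (real \<Rightarrow> real) \<Rightarrow> real ^ 2 \<Rightarrow> real" where
  "separated w C G x = C (angle w x) * G (log_norm x)"

lemma separated_derivative:
  assumes "cmod w = 1" "rot_complex w x \<notin> \<real>\<^sub>\<le>\<^sub>0"
    and C: "\<And>t. (C has_real_derivative C1 t) (at t)" and G: "\<And>t. (G has_real_derivative G1 t) (at t)"
  shows "separated w C G differentiable (at x)"
    and "partial_deriv i (separated w C G) x
      = (perp x i * separated w C1 G x + x $ i * separated w C G1 x) / (norm x)\<^sup>2"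
proof -
  have x: "x \<noteq> 0" using assms(2) by auto
  have dA: "angle w differentiable (at x)" and dL: "log_norm differentiable (at x)"
    using angle_has_derivative[OF assms(1,2)] log_norm_has_derivative[OF x]
    by (auto simp: differentiable_def)
  note d = differentiable_compose_real[OF dA C] differentiable_compose_real[OF dL G]
  show "separated w C G differentiable (at x)"
    unfolding separated_def[abs_def] using d by (rule differentiable_mult)
  show "partial_deriv i (separated w C G) x
      = (perp x i * separated w C1 G x + x $ i * separated w C G1 x) / (norm x)\<^sup>2"
    unfolding separated_def[abs_def] partial_deriv_mult[OF d]
      partial_deriv_compose[OF dA C] partial_deriv_compose[OF dL G]
      partial_deriv_angle[OF assms(1,2)] partial_deriv_log_norm[OF x]
    by (simp add: field_simps add_divide_distrib)
qed

text \<open>In the coordinates $s = \ln |x|$ and the angle $\vartheta$, the operator $|x|^2 a_{ij} \partial_{ij}$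
  is $\partial_{ss} + \varepsilon \partial_s + (1 + \varepsilon) \partial_{\vartheta\vartheta}$; this is its formal adjoint.\<close>

lemma double_div_separated:
  assumes w: "cmod w = 1" and V: "open V" "\<And>y. y \<in> V \<Longrightarrow> rot_complex w y \<notin> \<real>\<^sub>\<le>\<^sub>0"
    and C: "\<And>t. (C has_real_derivative C1 t) (at t)" "\<And>t. (C1 has_real_derivative C2 t) (at t)"
    and G: "\<And>t. (G has_real_derivative G1 t) (at t)" "\<And>t. (G1 has_real_derivative G2 t) (at t)"
    and \<psi>: "smooth_on V \<psi>" "\<And>y. y \<in> V \<Longrightarrow> \<psi> y = separated w C G y" and x: "x \<in> V"
  shows "double_div \<epsilon> \<psi> x = separated w C (\<lambda>t. G2 t + (4 - \<epsilon>) * G1 t + (4 - 2 * \<epsilon>) * G t) x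
    + (1 + \<epsilon>) * separated w C2 G x"
proof -
  \<comment> \<open>The inner divergence splits into a radial and a tangential field, again with
    separated coefficients, so the same gradient formula serves for the outer one. The constant 2 -
    \<epsilon> is the divergence of row i of \<open>coeff_poly\<close>, divided by the i-th
    coordinate.\<close>
  define F where "F i y = y $ i * separated w C (\<lambda>t. G1 t + (2 - \<epsilon>) * G t) y + (1 + \<epsilon>) * perp y i * separated w C1 G y" for i y
  have F: "(\<Sum>j\<in>UNIV. partial_deriv j (\<lambda>y. coeff_poly \<epsilon> i j y * \<psi> y) y) = F i y" if y: "y \<in> V" for i y
  proof -
    have dp: "\<psi> differentiable (at y)" using \<psi>(1) y by (rule smooth_on_imp_differentiable)
    have p: "partial_deriv j \<psi> y = (perp y j * separated w C1 G y + y $ j * separated w C G1 y) / (norm y)\<^sup>2" for j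
      using partial_deriv_cong[OF V(1) y \<psi>(2)] separated_derivative(2)[OF w V(2)[OF y] C(1) G(1)] by simp
    have db: "coeff_poly \<epsilon> i j differentiable (at y)" for i j
      by (rule smooth_on_imp_differentiable[OF smooth_on_coeff_poly]) simp
    have n: "(y $ 1)\<^sup>2 + (y $ 2)\<^sup>2 \<noteq> 0"
      using V(2)[OF y] rot_complex_eq_0_iff[OF w, of y] norm_power2_vec2[of y] by auto
    have b: "partial_deriv j (coeff_poly \<epsilon> i j) y = (if i = j then 2 else - \<epsilon>) * y $ i" for i j
      by (rule partial_deriv_coeff_poly)
    show ?thesis
      unfolding partial_deriv_mult[OF db dp] p b norm_power2_vec2 sum_2 F_def \<psi>(2)[OF y]
      using n exhaust_2[of i]
      by (auto simp: separated_def coeff_poly_def perp_def divide_simps) (simp_all add: algebra_simps power2_eq_square)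
  qed
  have GP: "((\<lambda>t. G1 t + (2 - \<epsilon>) * G t) has_real_derivative G2 t + (2 - \<epsilon>) * G1 t) (at t)" for t
    by (intro DERIV_add DERIV_cmult G)
  note wx = w V(2)[OF x]
  note sP = separated_derivative[OF wx C(1) GP] and sN = separated_derivative[OF wx C(2) G(1)]
  have dc: "(\<lambda>y. (1 + \<epsilon>) * perp y i) differentiable (at x)" for i
    by (intro differentiable_mult differentiable_const differentiable_perp)
  have pc: "partial_deriv i (\<lambda>y. (1 + \<epsilon>) * perp y i) x = 0" for i
    by (subst partial_deriv_mult[OF differentiable_const differentiable_perp])
      (simp add: partial_deriv_perp partial_deriv_def)
  have n: "x \<noteq> 0" using V(2)[OF x] by auto
  \<comment> \<open>The vector x and its quarter turn are orthogonal, both of squared length |x|^2,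
    so contracting a gradient with one of them isolates one of the two polar derivatives.\<close>
  have e: "x $ 1 * ((perp x 1 * a + x $ 1 * b) / (norm x)\<^sup>2) + x $ 2 * ((perp x 2 * a + x $ 2 * b) / (norm x)\<^sup>2) = b"
    and e': "perp x 1 * ((perp x 1 * a + x $ 1 * b) / (norm x)\<^sup>2) + perp x 2 * ((perp x 2 * a + x $ 2 * b) / (norm x)\<^sup>2) = a"
    for a b
  proof -
    have "x $ 1 * (perp x 1 * a + x $ 1 * b) + x $ 2 * (perp x 2 * a + x $ 2 * b) = b * (norm x)\<^sup>2"
      "perp x 1 * (perp x 1 * a + x $ 1 * b) + perp x 2 * (perp x 2 * a + x $ 2 * b) = a * (norm x)\<^sup>2"
      unfolding norm_power2_vec2 by (simp_all add: perp_def algebra_simps power2_eq_square)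
    then show "x $ 1 * ((perp x 1 * a + x $ 1 * b) / (norm x)\<^sup>2) + x $ 2 * ((perp x 2 * a + x $ 2 * b) / (norm x)\<^sup>2) = b"
      "perp x 1 * ((perp x 1 * a + x $ 1 * b) / (norm x)\<^sup>2) + perp x 2 * ((perp x 2 * a + x $ 2 * b) / (norm x)\<^sup>2) = a"
      using n unfolding times_divide_eq_right add_divide_distrib[symmetric] by simp_all
  qed
  have s: "(\<Sum>i\<in>UNIV. x $ i * A i + P + (1 + \<epsilon>) * perp x i * B i)
      = (x $ 1 * A 1 + x $ 2 * A 2) + 2 * P + (1 + \<epsilon>) * (perp x 1 * B 1 + perp x 2 * B 2)" for A B P
    by (simp add: sum_2 algebra_simps)
  have dd: "partial_deriv j (\<lambda>y. coeff_poly \<epsilon> i j y * \<psi> y) differentiable (at x)" for i j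
    using smooth_on_partial_deriv[OF smooth_on_mult[OF V(1)
        smooth_on_subset[OF smooth_on_coeff_poly subset_UNIV] \<psi>(1)]] x
    by (rule smooth_on_imp_differentiable)
  have "double_div \<epsilon> \<psi> x = (\<Sum>i\<in>UNIV. partial_deriv i
      (\<lambda>y. \<Sum>j\<in>UNIV. partial_deriv j (\<lambda>y. coeff_poly \<epsilon> i j y * \<psi> y) y) x)"
    unfolding double_div_def sum_2 by (simp only: partial_deriv_add[OF dd dd])
  also have "\<dots> = (\<Sum>i\<in>UNIV. partial_deriv i (F i) x)"
    by (intro sum.cong refl partial_deriv_cong[OF V(1) x] F)
  also have "\<dots> = (\<Sum>i\<in>UNIV. x $ i * partial_deriv i (separated w C (\<lambda>t. G1 t + (2 - \<epsilon>) * G t)) x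
      + separated w C (\<lambda>t. G1 t + (2 - \<epsilon>) * G t) x
      + (1 + \<epsilon>) * perp x i * partial_deriv i (separated w C1 G) x)"
    unfolding F_def[abs_def]
    by (intro sum.cong refl)
      (simp add: partial_deriv_add[OF differentiable_mult[OF differentiable_coord sP(1)] differentiable_mult[OF dc sN(1)]]
        partial_deriv_mult[OF differentiable_coord sP(1)] partial_deriv_mult[OF dc sN(1)] pc partial_deriv_coord)
  also have "\<dots> = separated w C (\<lambda>t. G2 t + (4 - \<epsilon>) * G1 t + (4 - 2 * \<epsilon>) * G t) x
    + (1 + \<epsilon>) * separated w C2 G x"
    unfolding s sP(2) sN(2) e e' by (simp add: separated_def algebra_simps)
  finally show ?thesis .
qed

section \<open>The test functions and the telescoping identity\<close>

lemma double_div_eq_0: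
  assumes "open V" "x \<in> V" "\<And>y. y \<in> V \<Longrightarrow> \<psi> y = 0"
  shows "double_div \<epsilon> \<psi> x = 0"
proof -
  have 0: "partial_deriv i (\<lambda>x. 0) y = 0" for i :: 2 and y by (simp add: partial_deriv_def)
  have "partial_deriv i (partial_deriv j (\<lambda>y. coeff_poly \<epsilon> i j y * \<psi> y)) x
      = partial_deriv i (\<lambda>y. 0) x" for i j
  proof (rule partial_deriv_cong[OF assms(1,2)])
    fix y assume "y \<in> V"
    then have "partial_deriv j (\<lambda>y. coeff_poly \<epsilon> i j y * \<psi> y) y = partial_deriv j (\<lambda>y. 0) y"
      using assms by (intro partial_deriv_cong[OF assms(1)]) auto
    then show "partial_deriv j (\<lambda>y. coeff_poly \<epsilon> i j y * \<psi> y) y = 0" by (simp add: 0)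
  qed
  then show ?thesis by (simp add: double_div_def 0)
qed

locale cutoff_data =
  fixes Z Z1 Z2 :: "real \<Rightarrow> real" and w :: complex and \<epsilon> \<mu> :: real
  assumes Z_deriv: "\<And>t. (Z has_real_derivative Z1 t) (at t)"
    and Z1_deriv: "\<And>t. (Z1 has_real_derivative Z2 t) (at t)"
    and Z2_cont: "continuous_on UNIV Z2"
    and Z_left: "\<And>t. t \<le> 0 \<Longrightarrow> Z t = 1 \<and> Z1 t = 0 \<and> Z2 t = 0"
    and Z_right: "\<And>t. t \<ge> 1 \<Longrightarrow> Z t = 0 \<and> Z1 t = 0 \<and> Z2 t = 0"
    and Z_antimono: "antimono Z"
    and Z_smooth: "\<And>(U :: (real ^ 2) set) f. open U \<Longrightarrow> smooth_on U f \<Longrightarrow> smooth_on U (\<lambda>x. Z (f x))"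
    and w: "cmod w = 1"
    and \<mu>: "(1 + \<epsilon>) * \<mu>\<^sup>2 = 4 + 2 * \<epsilon>"
begin

text \<open>On the branch cut - Re equals |x|. The affine argument makes the cutoff 1 for - Re \<le>
  |x| / 4 and 0 for - Re \<ge> |x| / 2: the jump of the angle is erased, while a half-plane opened
  up to slope 1/4 is left untouched.\<close>

definition sector :: "real ^ 2 \<Rightarrow> real" where
  "sector x = (if x = 0 then 0
     else Z (4 * (- Re (rot_complex w x) / norm x) - 1) * cos (\<mu> * angle w x))"

text \<open>A bump supported in a - 1 \<le> s \<le> a + 1. Being a difference of unit translates of
  one profile, it is mapped by the adjoint to such a difference again, and this is what
  telescopes.\<close>

definition radial :: "real \<Rightarrow> real \<Rightarrow> real" where
  "radial a s = Z (s - a) - Z (s - (a - 1))"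

definition test_fn :: "real \<Rightarrow> real ^ 2 \<Rightarrow> real" where
  "test_fn a x = sector x * (exp (- 4 * log_norm x) * radial a (log_norm x))"

text \<open>The image of a single translate of Z under the radial part of the adjoint, conjugated by
  exp(-4 s). The drift is - (4 + \<epsilon>) = (4 - \<epsilon>) - 8; the term of order zero is
  absent by the choice of \<open>\<mu>\<close>.\<close>

definition weight :: "real \<Rightarrow> real \<Rightarrow> real" where
  "weight a s = Z2 (s - a) - (4 + \<epsilon>) * Z1 (s - a)"

definition weight_fn :: "real \<Rightarrow> real ^ 2 \<Rightarrow> real" where
  "weight_fn a x = sector x * (exp (- 4 * log_norm x) * weight a (log_norm x))"

lemma Z_bounds: "0 \<le> Z t" "Z t \<le> 1"
  using Z_antimono[THEN antimonoD, of t "max t 1"] Z_right[of "max t 1"]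
    Z_antimono[THEN antimonoD, of "min t 0" t] Z_left[of "min t 0"] by auto

lemma radial_nonneg: "0 \<le> radial a s"
  using Z_antimono[THEN antimonoD, of "s - a" "s - (a - 1)"] by (simp add: radial_def)

lemma radial_le_1: "radial a s \<le> 1"
  using Z_bounds[of "s - a"] Z_bounds[of "s - (a - 1)"] by (simp add: radial_def)

lemma radial_eq_0: "s \<le> a - 1 \<or> s \<ge> a + 1 \<Longrightarrow> radial a s = 0"
  using Z_left[of "s - a"] Z_left[of "s - (a - 1)"] Z_right[of "s - a"] Z_right[of "s - (a - 1)"]
  by (auto simp: radial_def)

lemma weight_eq_0: "s \<le> a \<or> s \<ge> a + 1 \<Longrightarrow> weight a s = 0"
  using Z_left[of "s - a"] Z_right[of "s - a"] by (auto simp: weight_def)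

lemma Z_cont: "continuous_on UNIV Z" and Z1_cont: "continuous_on UNIV Z1"
  by (intro continuous_at_imp_continuous_on ballI; rule DERIV_isCont[OF Z_deriv] DERIV_isCont[OF Z1_deriv])+

lemma abs_sector_le_1: "\<bar>sector x\<bar> \<le> 1"
proof -
  have "Z t * \<bar>cos u\<bar> \<le> 1 * 1" for t u by (intro mult_mono Z_bounds abs_cos_le_one) auto
  then show ?thesis by (auto simp: sector_def abs_mult Z_bounds)
qed

lemma sector_eq_cos:
  assumes "x \<noteq> 0" "- Re (rot_complex w x) \<le> norm x / 4"
  shows "sector x = cos (\<mu> * angle w x)"
proof -
  have "4 * (- Re (rot_complex w x) / norm x) - 1 \<le> 0" using assms by (simp add: field_simps)
  then show ?thesis using Z_left assms(1) by (simp add: sector_def)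
qed

text \<open>Two open sets cover the punctured plane: the slit plane, where the angle is smooth, and
  the cone - 2 Re > |x| around the cut, where the cutoff is identically zero.\<close>

lemma smooth_on_sector: "smooth_on (- {0}) sector"
proof -
  let ?V = "{x. rot_complex w x \<notin> \<real>\<^sub>\<le>\<^sub>0}" and ?V' = "{x. norm x < - 2 * Re (rot_complex w x)}"
  have V0: "?V \<subseteq> - {0}" by auto
  have V': "open ?V'" by (intro open_Collect_less continuous_intros)
  have "- {0} = ?V \<union> ?V'"
  proof (intro set_eqI iffI)
    fix x assume "x \<in> - {0 :: real ^ 2}"
    then have "norm x > 0" by simp
    moreover have "Re (rot_complex w x) = - norm x" if "rot_complex w x \<in> \<real>\<^sub>\<le>\<^sub>0"
      using that norm_rot_complex[OF w, of x] by (auto elim!: nonpos_Reals_cases)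
    ultimately show "x \<in> ?V \<union> ?V'" by force
  qed auto
  moreover have "smooth_on ?V sector"
  proof (rule smooth_on_cong[OF _ open_slit])
    have "smooth_on ?V (\<lambda>x. Z (4 * (- (Re w * x $ 1 - Im w * x $ 2) * exp (- log_norm x)) - 1)
        * cos (\<mu> * angle w x))"
      by (intro smooth_on_mult smooth_on_cos Z_smooth smooth_on_diff smooth_on_minus smooth_on_exp
          smooth_on_const smooth_on_coord open_slit smooth_on_angle w smooth_on_subset[OF smooth_on_log_norm V0])
    then show "smooth_on ?V (\<lambda>x. Z (4 * (- (Re w * x $ 1 - Im w * x $ 2) * exp (- log_norm x)) - 1)
        * cos (\<mu> * angle w x))" .
    show "Z (4 * (- (Re w * x $ 1 - Im w * x $ 2) * exp (- log_norm x)) - 1) * cos (\<mu> * angle w x) = sector x"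
      if "x \<in> ?V" for x
    proof -
      have "x \<noteq> 0" using that by auto
      then show ?thesis
        by (simp add: sector_def rot_complex_def log_norm_def exp_minus divide_inverse)
    qed
  qed
  moreover have "smooth_on ?V' sector"
  proof (rule smooth_on_cong[OF smooth_on_const V'])
    show "0 = sector x" if "x \<in> ?V'" for x
    proof (cases "x = 0")
      case False
      then have "4 * (- Re (rot_complex w x) / norm x) - 1 \<ge> 1" using that by (simp add: field_simps)
      then show ?thesis using Z_right False by (simp add: sector_def)
    qed (simp add: sector_def)
  qed
  ultimately show ?thesis using smooth_on_Un[OF open_slit V'] by simp
qed

lemma test_fn_eq_0:
  assumes "norm x < exp (a - 1) \<or> exp (a + 1) < norm x"
  shows "test_fn a x = 0"
proof (cases "x = 0")
  case True
  then show ?thesis by (simp add: test_fn_def sector_def)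
next
  case False
  then have "norm x = exp (log_norm x)" by (simp add: log_norm_def)
  then have "log_norm x < a - 1 \<or> a + 1 < log_norm x" using assms by auto
  then show ?thesis using radial_eq_0 by (auto simp: test_fn_def)
qed

lemma weight_fn_eq_0:
  assumes "norm x \<le> exp a \<or> exp (a + 1) \<le> norm x"
  shows "weight_fn a x = 0"
proof (cases "x = 0")
  case True
  then show ?thesis by (simp add: weight_fn_def sector_def)
next
  case False
  then have "norm x = exp (log_norm x)" by (simp add: log_norm_def)
  then have "log_norm x \<le> a \<or> a + 1 \<le> log_norm x" using assms by auto
  then show ?thesis using weight_eq_0 by (auto simp: weight_fn_def)
qed

lemma test_function_test_fn:
  assumes "a + 1 < 0"
  shows "test_function (ball 0 1) (test_fn a)"
  unfolding test_function_iff
proof (intro conjI exI[of _ "cball 0 (exp (a + 1))"] allI impI)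
  have "smooth_on (- {0}) (test_fn a)"
    unfolding test_fn_def[abs_def] radial_def
    by (intro smooth_on_mult smooth_on_sector smooth_on_exp smooth_on_diff Z_smooth smooth_on_const
        smooth_on_log_norm) auto
  moreover have "smooth_on (ball 0 (exp (a - 1))) (test_fn a)"
    by (rule smooth_on_cong[OF smooth_on_const[of _ 0] open_ball]) (simp add: test_fn_eq_0)
  ultimately have "smooth_on (- {0} \<union> ball 0 (exp (a - 1))) (test_fn a)"
    by (intro smooth_on_Un) auto
  moreover have "- {0} \<union> ball (0 :: real ^ 2) (exp (a - 1)) = UNIV" by auto
  ultimately show "smooth_on UNIV (test_fn a)" by simp
  have "exp (a + 1) < 1" using assms by simp
  then show "cball 0 (exp (a + 1)) \<subseteq> ball (0 :: real ^ 2) 1" by (simp add: cball_subset_ball_iff)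
qed (auto intro: test_fn_eq_0)

lemma double_div_test_fn:
  assumes "x \<noteq> 0" "- Re (rot_complex w x) < norm x / 4"
  shows "double_div \<epsilon> (test_fn a) x = weight_fn a x - weight_fn (a - 1) x"
proof -
  define V where "V = {x. - Re (rot_complex w x) < norm x / 4}"
  have V: "open V" unfolding V_def by (intro open_Collect_less continuous_intros) auto
  have V': "rot_complex w y \<notin> \<real>\<^sub>\<le>\<^sub>0" if "y \<in> V" for y
    using that norm_rot_complex[OF w, of y] by (auto simp: V_def elim!: nonpos_Reals_cases)
  have ne: "y \<noteq> 0" if "y \<in> V" for y using that by (auto simp: V_def)
  define K K1 K2 where "K s = radial a s" and "K1 s = Z1 (s - a) - Z1 (s - (a - 1))"
    and "K2 s = Z2 (s - a) - Z2 (s - (a - 1))" for s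
  have sh: "((\<lambda>s. f (s - c)) has_real_derivative f' (t - c)) (at t)"
    if "\<And>t. (f has_real_derivative f' t) (at t)" for f f' :: "real \<Rightarrow> real" and c t
    using DERIV_shift[of f "f' (t - c)" t "- c"] that[of "t - c"] by simp
  have K: "(K has_real_derivative K1 t) (at t)" for t
    unfolding K_def radial_def K1_def by (intro DERIV_diff sh Z_deriv)
  have K1: "(K1 has_real_derivative K2 t) (at t)" for t
    unfolding K1_def K2_def by (intro DERIV_diff sh Z1_deriv)
  have E: "((\<lambda>t. exp (- 4 * t)) has_real_derivative - 4 * exp (- 4 * t)) (at t)" for t :: real
    by (auto intro!: derivative_eq_intros)
  have "double_div \<epsilon> (test_fn a) x = separated w (\<lambda>t. cos (\<mu> * t))
      (\<lambda>t. exp (- 4 * t) * (K2 t - 8 * K1 t + 16 * K t)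
         + (4 - \<epsilon>) * (exp (- 4 * t) * (K1 t - 4 * K t)) + (4 - 2 * \<epsilon>) * (exp (- 4 * t) * K t)) x
    + (1 + \<epsilon>) * separated w (\<lambda>t. - (\<mu>\<^sup>2 * cos (\<mu> * t))) (\<lambda>t. exp (- 4 * t) * K t) x"
  proof (rule double_div_separated[OF w V V', where ?C1.0 = "\<lambda>t. - (\<mu> * sin (\<mu> * t))"])
    show "((\<lambda>t. cos (\<mu> * t)) has_real_derivative - (\<mu> * sin (\<mu> * t))) (at t)" for t
      by (auto intro!: derivative_eq_intros)
    show "((\<lambda>t. - (\<mu> * sin (\<mu> * t))) has_real_derivative - (\<mu>\<^sup>2 * cos (\<mu> * t))) (at t)" for t
      by (auto intro!: derivative_eq_intros simp: power2_eq_square)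
    show "((\<lambda>t. exp (- 4 * t) * K t) has_real_derivative exp (- 4 * t) * (K1 t - 4 * K t)) (at t)" for t
      by (rule DERIV_cong[OF DERIV_mult[OF E K]]) (simp add: algebra_simps)
    show "((\<lambda>t. exp (- 4 * t) * (K1 t - 4 * K t)) has_real_derivative
        exp (- 4 * t) * (K2 t - 8 * K1 t + 16 * K t)) (at t)" for t
      by (rule DERIV_cong[OF DERIV_mult[OF E DERIV_diff[OF K1 DERIV_cmult[OF K]]]]) (simp add: algebra_simps)
    show "smooth_on V (test_fn a)"
      unfolding test_fn_def[abs_def] radial_def
      by (rule smooth_on_subset[where U = "- {0}"], intro smooth_on_mult smooth_on_sector smooth_on_exp
          smooth_on_diff Z_smooth smooth_on_const smooth_on_log_norm) (auto dest: ne)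
    show "test_fn a y = separated w (\<lambda>t. cos (\<mu> * t)) (\<lambda>t. exp (- 4 * t) * K t) y" if "y \<in> V" for y
      using that sector_eq_cos[OF ne[OF that]] by (simp add: test_fn_def separated_def K_def V_def)
  qed (use assms in \<open>simp_all add: V_def\<close>)
  also have "\<dots> = cos (\<mu> * angle w x) * exp (- 4 * log_norm x) *
      (K2 (log_norm x) - (4 + \<epsilon>) * K1 (log_norm x) + ((4 + 2 * \<epsilon>) - (1 + \<epsilon>) * \<mu>\<^sup>2) * K (log_norm x))"
    by (simp add: separated_def algebra_simps)
  \<comment> \<open>The undifferentiated cutoff drops out by the resonance condition. Only
    \<open>Z1\<close> and \<open>Z2\<close> remain, and each translate of them lives on one unit
    interval of s; this confines J to one annulus.\<close>
  also have "\<dots> = cos (\<mu> * angle w x) * exp (- 4 * log_norm x) * (K2 (log_norm x) - (4 + \<epsilon>) * K1 (log_norm x))"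
    unfolding \<mu> by simp
  also have "\<dots> = weight_fn a x - weight_fn (a - 1) x"
    using sector_eq_cos[OF assms(1)] assms(2)
    by (simp add: weight_fn_def weight_def K1_def K2_def algebra_simps)
  finally show ?thesis .
qed

section \<open>Bounds, measurability and the telescoping identity\<close>

lemma weight_bounded: obtains B where "B \<ge> 0" "\<And>a s. \<bar>weight a s\<bar> \<le> B"
proof -
  have "continuous_on {0..1} (weight 0)"
    unfolding weight_def
    by (intro continuous_intros continuous_on_compose2[OF Z1_cont] continuous_on_compose2[OF Z2_cont]) auto
  then have "bounded (weight 0 ` {0..1})"
    by (intro compact_imp_bounded compact_continuous_image) auto
  then obtain B where "\<forall>y\<in>weight 0 ` {0..1}. \<bar>y\<bar> \<le> B" unfolding bounded_real ..
  then have B: "\<And>s. 0 \<le> s \<Longrightarrow> s \<le> 1 \<Longrightarrow> \<bar>weight 0 s\<bar> \<le> B" by simp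
  show ?thesis
  proof (rule that[of "max B 0"])
    show "\<bar>weight a s\<bar> \<le> max B 0" for a s
    proof -
      have "weight a s = weight 0 (s - a)" by (simp add: weight_def)
      then show ?thesis
        using B[of "s - a"] weight_eq_0[of "s - a" 0] by (cases "s - a \<le> 0 \<or> s - a \<ge> 1") auto
    qed
  qed simp
qed

lemma weight_fn_bounded: obtains B where "B \<ge> 0" "\<And>a x. \<bar>weight_fn a x\<bar> \<le> B * exp (- 4 * a)"
proof -
  obtain B where B: "B \<ge> 0" "\<And>a s. \<bar>weight a s\<bar> \<le> B" by (rule weight_bounded) blast
  have "\<bar>weight_fn a x\<bar> \<le> B * exp (- 4 * a)" for a x
  proof (cases "norm x \<le> exp a")
    case True
    then show ?thesis using B(1) by (simp add: weight_fn_eq_0)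
  next
    case False
    then have "norm x > 0" by (smt (verit) exp_gt_zero)
    then have "a \<le> log_norm x" using False by (simp add: log_norm_def ln_ge_iff)
    then have "\<bar>sector x\<bar> * (exp (- 4 * log_norm x) * \<bar>weight a (log_norm x)\<bar>) \<le> 1 * (exp (- 4 * a) * B)"
      by (intro mult_mono abs_sector_le_1 B) auto
    then show ?thesis by (simp add: weight_fn_def abs_mult mult.commute)
  qed
  with B(1) show ?thesis by (rule that)
qed

lemma log_norm_measurable [measurable]: "log_norm \<in> borel_measurable borel"
  unfolding log_norm_def[abs_def] by measurable

lemma sector_measurable [measurable]: "sector \<in> borel_measurable borel"
proof -
  have "(\<lambda>x. indicator (- {0}) x *\<^sub>R sector x) \<in> borel_measurable borel"
    by (intro borel_measurable_continuous_on_indicator smooth_on_imp_continuous_on smooth_on_sector) auto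
  moreover have "(\<lambda>x. indicator (- {0}) x *\<^sub>R sector x) = sector"
    by (auto simp: fun_eq_iff indicator_def sector_def)
  ultimately show ?thesis by simp
qed

lemma weight_fn_measurable [measurable]: "weight_fn a \<in> borel_measurable borel"
proof -
  have [measurable]: "Z1 \<in> borel_measurable borel" "Z2 \<in> borel_measurable borel"
    using Z1_cont Z2_cont by (auto intro: borel_measurable_continuous_onI)
  show ?thesis unfolding weight_fn_def[abs_def] weight_def by measurable
qed

lemma radial_measurable [measurable]: "radial a \<in> borel_measurable borel"
proof -
  have [measurable]: "Z \<in> borel_measurable borel"
    using Z_cont by (auto intro: borel_measurable_continuous_onI)
  show ?thesis unfolding radial_def[abs_def] by measurable
qed

lemma integrable_weight_fn:
  assumes "L1_loc (ball 0 1) v" "a + 1 < 0"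
  shows "integrable lebesgue (\<lambda>x. v x * weight_fn a x)"
proof -
  obtain B where B: "\<And>a x. \<bar>weight_fn a x\<bar> \<le> B * exp (- 4 * a)" by (rule weight_fn_bounded) blast
  show ?thesis
  proof (rule integrable_L1_loc_mult[OF assms(1) compact_cball _ _ B])
    have "exp (a + 1) < 1" using assms(2) by simp
    then show "cball 0 (exp (a + 1)) \<subseteq> ball (0 :: real ^ 2) 1" by (simp add: cball_subset_ball_iff)
    show "weight_fn a \<in> borel_measurable lebesgue" by (simp add: measurable_completion)
  qed (simp add: weight_fn_eq_0)
qed

text \<open>The adjoint is computed only inside the cone, but multiplication by v extends the
  identity to every x: off the positivity set v = 0 because v is nonnegative, while at the origin
  and from radius \<open>\<rho>\<close> on the test function and both weights vanish.\<close>

lemma telescoping: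
  assumes sol: "strong_solution (coeff_matrix \<epsilon>) v" and nonneg: "\<forall>x\<in>ball 0 1. v x \<ge> 0"
    and \<rho>: "\<rho> \<le> 1" "\<And>x. x \<in> positivity_set v \<Longrightarrow> norm x < \<rho> \<Longrightarrow> x \<noteq> 0 \<Longrightarrow> - Re (rot_complex w x) < norm x / 4"
    and a: "exp (a + 1) < \<rho>"
  shows "(\<integral>x. v x * weight_fn a x \<partial>lebesgue) - (\<integral>x. v x * weight_fn (a - 1) x \<partial>lebesgue)
    = (\<integral>x. indicator (positivity_set v) x * ((norm x)\<^sup>2 * test_fn a x) \<partial>lebesgue)"
proof -
  have L1: "L1_loc (ball 0 1) v"
    using sol by (auto simp: strong_solution_def W22_loc_with_def weak_partial_deriv_def)
  have "exp (a + 1) < 1" using a \<rho>(1) by linarith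
  then have a0: "a + 1 < 0" by simp
  have "v x * double_div \<epsilon> (test_fn a) x = v x * weight_fn a x - v x * weight_fn (a - 1) x" for x
  proof -
    consider "norm x \<ge> \<rho>" | "x = 0" | "norm x < \<rho>" "x \<notin> positivity_set v"
      | "norm x < \<rho>" "x \<noteq> 0" "x \<in> positivity_set v" by linarith
    then show ?thesis
    proof cases
      case 1
      have "double_div \<epsilon> (test_fn a) x = 0"
        by (rule double_div_eq_0[of "- cball 0 (exp (a + 1))"]) (use 1 a in \<open>auto intro: test_fn_eq_0\<close>)
      moreover have "exp (a - 1 + 1) < exp (a + 1)" by simp
      then have "weight_fn (a - 1) x = 0" using 1 a by (intro weight_fn_eq_0) linarith
      ultimately show ?thesis using 1 a by (simp add: weight_fn_eq_0)
    next
      case 2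
      have "double_div \<epsilon> (test_fn a) x = 0"
        by (rule double_div_eq_0[of "ball 0 (exp (a - 1))"]) (use 2 in \<open>auto intro: test_fn_eq_0\<close>)
      then show ?thesis using 2 by (simp add: weight_fn_eq_0)
    next
      case 3
      then have "x \<in> ball 0 1" using \<rho>(1) by simp
      then have "v x = 0" using nonneg 3(2) by (auto simp: positivity_set_def intro: antisym)
      then show ?thesis by simp
    next
      case 4
      then show ?thesis using double_div_test_fn[OF 4(2) \<rho>(2)] by (simp add: right_diff_distrib)
    qed
  qed
  then have "(\<integral>x. v x * double_div \<epsilon> (test_fn a) x \<partial>lebesgue)
      = (\<integral>x. v x * weight_fn a x \<partial>lebesgue) - (\<integral>x. v x * weight_fn (a - 1) x \<partial>lebesgue)"
    using integrable_weight_fn[OF L1 a0] integrable_weight_fn[OF L1, of "a - 1"] a0 by simp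
  then show ?thesis
    using strong_solution_double_div[OF sol test_function_test_fn[OF a0]] by simp
qed

end

section \<open>Evaluation of the limiting integral\<close>

lemma lebesgue_integral_linear:
  fixes f :: "real ^ 2 \<Rightarrow> real"
  assumes "linear g" "det (matrix g) \<noteq> 0" "integrable lebesgue f"
  shows "integrable lebesgue (\<lambda>x. f (g x))"
    and "(\<integral>x. f x \<partial>lebesgue) = \<bar>det (matrix g)\<bar> * (\<integral>x. f (g x) \<partial>lebesgue)"
proof -
  \<comment> \<open>The change of variables formula is applied to functions with values in
    \<open>real ^ 1\<close>; f is sent there and recovered from the single component.\<close>
  define F where "F x = f x *\<^sub>R (axis 1 1 :: real ^ 1)" for x
  have UN: "g ` UNIV = UNIV"
  proof -
    have "inj g" using assms(1,2) det_nz_iff_inj by blast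
    then show ?thesis using assms(1) linear_injective_imp_surjective by blast
  qed
  have iF: "integrable lebesgue F" unfolding F_def using assms(3) by simp
  then have aF: "F absolutely_integrable_on (g ` UNIV)"
    unfolding UN by (simp add: set_integrable_def)
  then have "(F \<circ> g) absolutely_integrable_on UNIV"
    using absolutely_integrable_on_linear_image[OF assms(1)] assms(2) by blast
  then have iFg: "integrable lebesgue (F \<circ> g)" by (simp add: set_integrable_def o_def)
  have "integrable lebesgue (\<lambda>x. (F \<circ> g) x $ 1)"
    by (rule integrable_bounded_linear[OF bounded_linear_vec_nth iFg])
  then show ifg: "integrable lebesgue (\<lambda>x. f (g x))" by (simp add: F_def)
  have "integral (g ` UNIV) F = \<bar>det (matrix g)\<bar> *\<^sub>R integral UNIV (F \<circ> g)"
    using integral_change_of_variables_linear[OF assms(1)] aF by blast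
  then have "(\<integral>x. F x \<partial>lebesgue) = \<bar>det (matrix g)\<bar> *\<^sub>R (\<integral>x. (F \<circ> g) x \<partial>lebesgue)"
    unfolding UN integral_lebesgue[OF iF] integral_lebesgue[OF iFg] .
  then have "(\<integral>x. f x \<partial>lebesgue) *\<^sub>R (axis 1 1 :: real ^ 1) =
      \<bar>det (matrix g)\<bar> *\<^sub>R ((\<integral>x. f (g x) \<partial>lebesgue) *\<^sub>R axis 1 1)"
    unfolding F_def o_def using assms(3) ifg by (simp add: integral_scaleR_left)
  then have "((\<integral>x. f x \<partial>lebesgue) *\<^sub>R (axis 1 1 :: real ^ 1)) $ 1 =
      (\<bar>det (matrix g)\<bar> *\<^sub>R ((\<integral>x. f (g x) \<partial>lebesgue) *\<^sub>R (axis 1 1 :: real ^ 1))) $ 1"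
    by (rule arg_cong)
  then show "(\<integral>x. f x \<partial>lebesgue) = \<bar>det (matrix g)\<bar> * (\<integral>x. f (g x) \<partial>lebesgue)"
    by simp
qed

lemma lebesgue_integral_scale:
  fixes f :: "real ^ 2 \<Rightarrow> real"
  assumes "c > 0" "integrable lebesgue f"
  shows "(\<integral>x. f x \<partial>lebesgue) = c\<^sup>2 * (\<integral>x. f (c *\<^sub>R x) \<partial>lebesgue)"
proof -
  have d: "det (matrix ((*\<^sub>R) c :: real ^ 2 \<Rightarrow> real ^ 2)) = c\<^sup>2"
    by (simp add: matrix_scaleR det_2 mat_def power2_eq_square)
  have "linear ((*\<^sub>R) c :: real ^ 2 \<Rightarrow> real ^ 2)" by (rule linear_scaleR)
  from lebesgue_integral_linear(2)[OF this _ assms(2)] assms(1) show ?thesis by (simp add: d)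
qed

definition plane_rotation :: "real \<Rightarrow> real ^ 2 \<Rightarrow> real ^ 2" where
  "plane_rotation h x = vector [vector [cos h, - sin h], vector [sin h, cos h]] *v x"

lemma rot_complex_plane_rotation: "rot_complex w (plane_rotation h x) = cis h * rot_complex w x"
  by (simp add: rot_complex_def plane_rotation_def matrix_vector_mult_def sum_2 complex_eq_iff algebra_simps)

lemma lebesgue_integral_rotation:
  fixes f :: "real ^ 2 \<Rightarrow> real"
  assumes "integrable lebesgue f"
  shows "(\<integral>x. f x \<partial>lebesgue) = (\<integral>x. f (plane_rotation h x) \<partial>lebesgue)"
proof -
  have "matrix (plane_rotation h) = vector [vector [cos h, - sin h], vector [sin h, cos h]]"
    unfolding plane_rotation_def[abs_def] by (simp add: matrix_of_matrix_vector_mul)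
  then have d: "det (matrix (plane_rotation h)) = 1"
    using sin_cos_squared_add2[of h] by (simp add: det_2 power2_eq_square)
  have "linear (plane_rotation h)"
    unfolding plane_rotation_def[abs_def] by (rule matrix_vector_mul_linear)
  from lebesgue_integral_linear(2)[OF this _ assms] show ?thesis by (simp add: d)
qed

section \<open>Angles and wedges under rotation\<close>

lemma angle_rotation:
  assumes "rot_complex w x \<noteq> 0" "- pi < angle w x + h" "angle w x + h \<le> pi"
  shows "angle w (plane_rotation h x) = angle w x + h"
proof -
  have "rot_complex w (plane_rotation h x) = exp (Ln (rot_complex w x) + \<i> * of_real h)"
    using assms(1) by (simp add: rot_complex_plane_rotation exp_add cis_conv_exp)
  moreover have "Ln (exp (Ln (rot_complex w x) + \<i> * of_real h)) = Ln (rot_complex w x) + \<i> * of_real h"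
    using assms(2,3) by (intro Ln_exp) (simp_all add: angle_def)
  ultimately show ?thesis by (simp add: angle_def)
qed

lemma angle_scale: "c > 0 \<Longrightarrow> x \<noteq> 0 \<Longrightarrow> cmod w = 1 \<Longrightarrow> angle w (c *\<^sub>R x) = angle w x"
  using rot_complex_eq_0_iff[of w x] Ln_times_of_real[of c "rot_complex w x"]
    linear_cmul[OF linear_rot_complex, of w c x]
  by (simp add: angle_def scaleR_conv_of_real)

lemma angle_eq_pi_iff:
  assumes "rot_complex w x \<noteq> 0"
  shows "rot_complex w x \<in> \<real>\<^sub>\<le>\<^sub>0 \<longleftrightarrow> angle w x = pi"
  using Im_Ln_eq_pi[OF assms] assms
  by (auto simp: angle_def complex_nonpos_Reals_iff complex_eq_iff)

text \<open>Half-open, so that adjacent wedges partition their union; the branch cut and the origin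
  are left out.\<close>

definition wedge :: "complex \<Rightarrow> real \<Rightarrow> real \<Rightarrow> (real ^ 2) set" where
  "wedge w \<alpha> \<beta> = {x. rot_complex w x \<notin> \<real>\<^sub>\<le>\<^sub>0 \<and> \<alpha> \<le> angle w x \<and> angle w x < \<beta>}"

lemma wedge_borel [measurable]:
  assumes "cmod w = 1"
  shows "wedge w \<alpha> \<beta> \<in> sets borel"
proof -
  let ?V = "{x. rot_complex w x \<notin> \<real>\<^sub>\<le>\<^sub>0}"
  have [measurable]: "?V \<in> sets borel" using open_slit by (rule borel_open)
  have [measurable]: "(\<lambda>x. indicator ?V x *\<^sub>R angle w x) \<in> borel_measurable borel"
    by (intro borel_measurable_continuous_on_indicator smooth_on_imp_continuous_on smooth_on_angle assms) auto
  have "wedge w \<alpha> \<beta> = ?V \<inter> {x \<in> space borel. \<alpha> \<le> indicator ?V x *\<^sub>R angle w x \<and> indicator ?V x *\<^sub>R angle w x < \<beta>}"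
    by (auto simp: wedge_def)
  also have "\<dots> \<in> sets borel" by measurable
  finally show ?thesis .
qed

text \<open>The bounds keep both wedges within one branch of the argument, so the angle is additive
  under the rotation and under its inverse.\<close>

lemma plane_rotation_mem_wedge_iff:
  assumes "cmod w = 1" "- pi < \<alpha>" "\<alpha> \<le> \<alpha> + h" "\<beta> + h \<le> pi"
  shows "plane_rotation h x \<in> wedge w (\<alpha> + h) (\<beta> + h) \<longleftrightarrow> x \<in> wedge w \<alpha> \<beta>"
proof (cases "rot_complex w x = 0")
  case True
  then show ?thesis by (auto simp: wedge_def rot_complex_plane_rotation)
next
  case False
  have inv: "rot_complex w (plane_rotation (- h) (plane_rotation h x)) = rot_complex w x"
    by (simp add: rot_complex_plane_rotation cis_mult mult.assoc[symmetric])
  have ne: "rot_complex w (plane_rotation h x) \<noteq> 0" using False by (simp add: rot_complex_plane_rotation)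
  show ?thesis
  proof
    assume "x \<in> wedge w \<alpha> \<beta>"
    then have x: "\<alpha> \<le> angle w x" "angle w x < \<beta>" by (auto simp: wedge_def)
    then have e: "angle w (plane_rotation h x) = angle w x + h"
      using assms False by (intro angle_rotation) auto
    then have "rot_complex w (plane_rotation h x) \<notin> \<real>\<^sub>\<le>\<^sub>0"
      using angle_eq_pi_iff[OF ne] x assms by auto
    then show "plane_rotation h x \<in> wedge w (\<alpha> + h) (\<beta> + h)" using e x by (simp add: wedge_def)
  next
    assume "plane_rotation h x \<in> wedge w (\<alpha> + h) (\<beta> + h)"
    then have x: "\<alpha> + h \<le> angle w (plane_rotation h x)" "angle w (plane_rotation h x) < \<beta> + h"
      by (auto simp: wedge_def)
    then have "angle w (plane_rotation (- h) (plane_rotation h x)) = angle w (plane_rotation h x) + - h"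
      using assms ne by (intro angle_rotation) auto
    then have e: "angle w x = angle w (plane_rotation h x) - h"
      using inv by (simp add: angle_def)
    then have "rot_complex w x \<notin> \<real>\<^sub>\<le>\<^sub>0"
      using angle_eq_pi_iff[OF False] x assms by auto
    then show "x \<in> wedge w \<alpha> \<beta>" using e x by (simp add: wedge_def)
  qed
qed

section \<open>The scale-invariant kernel and integrals over wedges\<close>

context cutoff_data
begin

definition kern :: "real \<Rightarrow> real ^ 2 \<Rightarrow> real" where
  "kern a x = (norm x)\<^sup>2 * (exp (- 4 * log_norm x) * radial a (log_norm x))"

lemma kern_eq_exp: "x \<noteq> 0 \<Longrightarrow> kern a x = exp (- 2 * log_norm x) * radial a (log_norm x)"
proof -
  assume "x \<noteq> 0"
  then have e: "norm x = exp (log_norm x)" by (simp add: log_norm_def)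
  have "(norm x)\<^sup>2 = exp (2 * log_norm x)" by (subst e) (simp add: exp_double)
  then have "(norm x)\<^sup>2 * exp (- 4 * log_norm x) = exp (- 2 * log_norm x)"
    by (simp add: exp_add[symmetric])
  then show ?thesis unfolding kern_def mult.assoc[symmetric] by simp
qed

lemma kern_measurable [measurable]: "kern a \<in> borel_measurable borel"
  unfolding kern_def[abs_def] by measurable

lemma kern_nonneg: "0 \<le> kern a x"
  by (simp add: kern_def radial_nonneg)

lemma kern_bound: "kern a x \<le> exp (2 - 2 * a) * indicator (cball 0 (exp (a + 1))) x"
proof (cases "x = 0 \<or> log_norm x \<le> a - 1 \<or> log_norm x \<ge> a + 1")
  case True
  then have "kern a x = 0" using radial_eq_0 by (auto simp: kern_def)
  then show ?thesis by simp
next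
  case False
  then have "norm x = exp (log_norm x)" by (simp add: log_norm_def)
  then have "norm x \<le> exp (a + 1)" using False by simp
  moreover have "exp (- 2 * log_norm x) * radial a (log_norm x) \<le> exp (2 - 2 * a) * 1"
    using False by (intro mult_mono radial_le_1 radial_nonneg) auto
  ultimately show ?thesis using False by (simp add: kern_eq_exp)
qed

text \<open>Homogeneity of degree -2 balances the area element: after rescaling, the integrals for
  all a use the one kernel \<open>kern 0\<close>, and only the domain still depends on a.\<close>

lemma kern_scale: "c > 0 \<Longrightarrow> kern (ln c) (c *\<^sub>R x) = kern 0 x / c\<^sup>2"
proof (cases "x = 0")
  case False
  assume c: "c > 0"
  have l: "log_norm (c *\<^sub>R x) = ln c + log_norm x"
    using c False by (simp add: log_norm_def ln_mult)
  have "radial (ln c) (ln c + log_norm x) = radial 0 (log_norm x)" by (simp add: radial_def)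
  moreover have "exp (- 2 * (ln c + log_norm x)) = exp (- 2 * log_norm x) / c\<^sup>2"
  proof -
    have "exp (- 2 * (ln c + log_norm x)) = exp (- 2 * log_norm x) * inverse (exp (ln c) * exp (ln c))"
      by (simp add: exp_add[symmetric] exp_minus[symmetric])
    then show ?thesis using c by (simp add: power2_eq_square divide_inverse)
  qed
  ultimately show ?thesis using c False by (simp add: kern_eq_exp l)
qed (simp add: kern_def)

lemma integrable_bounded_kern:
  assumes "g \<in> borel_measurable lebesgue" "\<And>x. \<bar>g x\<bar> \<le> 1"
  shows "integrable lebesgue (\<lambda>x. g x * kern a x)"
proof -
  have k: "integrable lebesgue (kern a)"
  proof (rule Bochner_Integration.integrable_bound)
    have "integrable lebesgue (indicator (cball (0 :: real ^ 2) (exp (a + 1))) :: _ \<Rightarrow> real)"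
      using lmeasurable_cball[of "0 :: real ^ 2" "exp (a + 1)"]
      by (simp add: integrable_indicator_iff fmeasurable_def)
    then show "integrable lebesgue (\<lambda>x. exp (2 - 2 * a) * indicator (cball (0 :: real ^ 2) (exp (a + 1))) x :: real)"
      by simp
    show "kern a \<in> borel_measurable lebesgue" by (simp add: measurable_completion)
    show "AE x in lebesgue. norm (kern a x) \<le> norm (exp (2 - 2 * a) * indicator (cball (0 :: real ^ 2) (exp (a + 1))) x :: real)"
      using kern_bound kern_nonneg by (intro AE_I2) (simp add: order_trans[OF kern_bound] abs_of_nonneg)
  qed
  from integrable_bounded_mult[OF this assms] show ?thesis by (simp add: mult.commute)
qed

text \<open>The phase p is carried along because a rotation by h turns cos(\<mu> \<theta>) into
  cos(\<mu> \<theta> + \<mu> h).\<close>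

definition wedge_integral :: "real \<Rightarrow> real \<Rightarrow> real \<Rightarrow> real" where
  "wedge_integral \<alpha> \<beta> p = (\<integral>x. indicator (wedge w \<alpha> \<beta>) x * cos (\<mu> * angle w x + p) * kern 0 x \<partial>lebesgue)"

lemma cos_wedge_measurable:
  "(\<lambda>x. indicator (wedge w \<alpha> \<beta>) x * cos (\<mu> * angle w x + p)) \<in> borel_measurable lebesgue"
proof -
  let ?V = "{x. rot_complex w x \<notin> \<real>\<^sub>\<le>\<^sub>0}"
  have [measurable]: "(\<lambda>x. indicator ?V x *\<^sub>R angle w x) \<in> borel_measurable borel"
    by (intro borel_measurable_continuous_on_indicator smooth_on_imp_continuous_on smooth_on_angle w
        borel_open open_slit)
  note wedge_borel[OF w, measurable]
  have "(\<lambda>x. indicator (wedge w \<alpha> \<beta>) x * cos (\<mu> * (indicator ?V x *\<^sub>R angle w x) + p)) \<in> borel_measurable borel"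
    by measurable
  moreover have "(\<lambda>x. indicator (wedge w \<alpha> \<beta>) x * cos (\<mu> * (indicator ?V x *\<^sub>R angle w x) + p))
      = (\<lambda>x. indicator (wedge w \<alpha> \<beta>) x * cos (\<mu> * angle w x + p))"
    by (auto simp: fun_eq_iff indicator_def wedge_def)
  ultimately show ?thesis by (simp add: measurable_completion)
qed

lemma integrable_wedge:
  "integrable lebesgue (\<lambda>x. indicator (wedge w \<alpha> \<beta>) x * cos (\<mu> * angle w x + p) * kern 0 x)"
  by (rule integrable_bounded_kern[OF cos_wedge_measurable]) (auto simp: indicator_def)

lemma norm_plane_rotation: "norm (plane_rotation h x) = norm x"
  using norm_rot_complex[OF w] rot_complex_plane_rotation[of w h x]
  by (metis norm_cis norm_mult mult_1)

text \<open>A rotation by h moves the integral over the upper half to the lower half at the price of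
  a phase \<open>\<mu> * h\<close>, and the sum of the two cosines becomes a product. Repeated
  halving takes the place of polar coordinates.\<close>

lemma wedge_integral_halve:
  assumes "- pi < m - h" "0 \<le> h" "m + h \<le> pi"
  shows "wedge_integral (m - h) (m + h) p = 2 * cos (\<mu> * h / 2) * wedge_integral (m - h) m (p + \<mu> * h / 2)"
proof -
  have "wedge_integral m (m + h) p = (\<integral>x. indicator (wedge w m (m + h)) (plane_rotation h x)
      * cos (\<mu> * angle w (plane_rotation h x) + p) * kern 0 (plane_rotation h x) \<partial>lebesgue)"
    unfolding wedge_integral_def by (rule lebesgue_integral_rotation[OF integrable_wedge])
  also have "\<dots> = wedge_integral (m - h) m (p + \<mu> * h)"
    unfolding wedge_integral_def
  proof (rule Bochner_Integration.integral_cong[OF refl])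
    fix x
    have "plane_rotation h x \<in> wedge w m (m + h) \<longleftrightarrow> x \<in> wedge w (m - h) m"
      using plane_rotation_mem_wedge_iff[OF w, of "m - h" h m x] assms by simp
    moreover have "angle w (plane_rotation h x) = angle w x + h" if "x \<in> wedge w (m - h) m"
      using that assms by (intro angle_rotation) (auto simp: wedge_def)
    moreover have "kern 0 (plane_rotation h x) = kern 0 x"
      by (simp add: kern_def norm_plane_rotation log_norm_def)
    ultimately show "indicator (wedge w m (m + h)) (plane_rotation h x)
        * cos (\<mu> * angle w (plane_rotation h x) + p) * kern 0 (plane_rotation h x)
      = indicator (wedge w (m - h) m) x * cos (\<mu> * angle w x + (p + \<mu> * h)) * kern 0 x"
      by (cases "x \<in> wedge w (m - h) m") (auto simp: algebra_simps)
  qed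
  finally have r: "wedge_integral m (m + h) p = wedge_integral (m - h) m (p + \<mu> * h)" .
  have "wedge_integral (m - h) (m + h) p = wedge_integral (m - h) m p + wedge_integral m (m + h) p"
    unfolding wedge_integral_def Bochner_Integration.integral_add[OF integrable_wedge integrable_wedge, symmetric]
    using assms by (intro Bochner_Integration.integral_cong[OF refl]) (auto simp: wedge_def indicator_def)
  also have "\<dots> = wedge_integral (m - h) m p + wedge_integral (m - h) m (p + \<mu> * h)" by (simp add: r)
  also have "\<dots> = (\<integral>x. 2 * cos (\<mu> * h / 2) *
      (indicator (wedge w (m - h) m) x * cos (\<mu> * angle w x + (p + \<mu> * h / 2)) * kern 0 x) \<partial>lebesgue)"
    unfolding wedge_integral_def Bochner_Integration.integral_add[OF integrable_wedge integrable_wedge, symmetric]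
  proof (rule Bochner_Integration.integral_cong[OF refl])
    fix x
    have "cos (\<mu> * angle w x + p) + cos (\<mu> * angle w x + (p + \<mu> * h))
        = 2 * cos (\<mu> * h / 2) * cos (\<mu> * angle w x + (p + \<mu> * h / 2))"
    proof -
      define u d where "u = \<mu> * angle w x + (p + \<mu> * h / 2)" and "d = \<mu> * h / 2"
      have e: "\<mu> * angle w x + p = u - d" "\<mu> * angle w x + (p + \<mu> * h) = u + d"
        by (simp_all add: u_def d_def field_simps)
      have "cos (u - d) + cos (u + d) = 2 * cos d * cos u" by (simp add: cos_add cos_diff)
      then show ?thesis unfolding e[symmetric] unfolding u_def d_def .
    qed
    then show "indicator (wedge w (m - h) m) x * cos (\<mu> * angle w x + p) * kern 0 x
      + indicator (wedge w (m - h) m) x * cos (\<mu> * angle w x + (p + \<mu> * h)) * kern 0 x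
      = 2 * cos (\<mu> * h / 2) * (indicator (wedge w (m - h) m) x * cos (\<mu> * angle w x + (p + \<mu> * h / 2)) * kern 0 x)"
      by (cases "x \<in> wedge w (m - h) m") (auto simp: distrib_right[symmetric])
  qed
  also have "\<dots> = 2 * cos (\<mu> * h / 2) * wedge_integral (m - h) m (p + \<mu> * h / 2)"
    by (simp add: wedge_integral_def)
  finally show ?thesis .
qed

end

lemma Re_rot_complex: "cmod w = 1 \<Longrightarrow> Re (rot_complex w x) = norm x * cos (angle w x)"
proof (cases "x = 0")
  case False
  assume w: "cmod w = 1"
  then have z: "rot_complex w x \<noteq> 0" using False rot_complex_eq_0_iff by auto
  have e: "exp (Re (Ln (rot_complex w x))) = norm x"
    by (simp only: norm_exp_eq_Re[symmetric] exp_Ln[OF z] norm_rot_complex[OF w])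
  have "Re (rot_complex w x) = Re (exp (Ln (rot_complex w x)))" using z by simp
  also have "\<dots> = norm x * cos (angle w x)" unfolding Re_exp e angle_def ..
  finally show ?thesis .
qed simp

context cutoff_data
begin

text \<open>The bisector of the wedge is at -3 pi/8, and the phase centres the cosine there: its
  argument is at most \<mu> pi/8 < pi/2 in absolute value, so the integrand is nonnegative.\<close>

lemma wedge_integral_pos:
  assumes "0 < \<mu>" "\<mu> < 4"
  shows "wedge_integral (- pi / 2) (- pi / 4) (3 * \<mu> * pi / 8) > 0"
proof -
  let ?W = "wedge w (- pi / 2) (- pi / 4)" and ?p = "3 * \<mu> * pi / 8"
  let ?f = "\<lambda>x. indicator ?W x * cos (\<mu> * angle w x + ?p) * kern 0 x"
  have c: "cos (\<mu> * angle w x + ?p) > 0" if "x \<in> ?W" for x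
  proof (rule cos_gt_zero_pi)
    have "\<mu> * (- pi / 2) \<le> \<mu> * angle w x"
      by (rule mult_left_mono) (use that assms in \<open>simp_all add: wedge_def\<close>)
    moreover have "\<mu> * angle w x < \<mu> * (- pi / 4)"
      by (rule mult_strict_left_mono) (use that assms in \<open>simp_all add: wedge_def\<close>)
    moreover have "\<mu> * pi < 4 * pi" using assms by simp
    ultimately show "- (pi / 2) < \<mu> * angle w x + ?p" "\<mu> * angle w x + ?p < pi / 2"
      by linarith+
  qed
  have nn: "?f x \<ge> 0" for x
    using c[of x] kern_nonneg[of 0 x] by (cases "x \<in> ?W") auto
  have "wedge_integral (- pi / 2) (- pi / 4) ?p \<ge> 0"
    unfolding wedge_integral_def by (rule Bochner_Integration.integral_nonneg) (rule nn)
  moreover have "wedge_integral (- pi / 2) (- pi / 4) ?p \<noteq> 0"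
  proof
    assume "wedge_integral (- pi / 2) (- pi / 4) ?p = 0"
    then have ae: "AE x in lebesgue. ?f x = 0"
      unfolding wedge_integral_def
      using integral_nonneg_eq_0_iff_AE[OF integrable_wedge[of "- pi / 2" "- pi / 4" ?p]] nn by simp
    let ?V = "{x. rot_complex w x \<notin> \<real>\<^sub>\<le>\<^sub>0}"
    \<comment> \<open>An open set on which the integrand is positive; once it is seen to be
      nonempty, it cannot be negligible.\<close>
    let ?O = "?V \<inter> (\<lambda>x. (angle w x, radial 0 (log_norm x))) -` ({- pi / 2<..<- pi / 4} \<times> {0<..})"
    have V0: "?V \<subseteq> - {0}" by auto
    have cr: "continuous_on UNIV (radial 0)"
      unfolding radial_def[abs_def]
      by (intro continuous_intros continuous_on_compose2[OF Z_cont]) auto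
    have "continuous_on ?V (\<lambda>x. (angle w x, radial 0 (log_norm x)))"
      by (intro continuous_on_Pair smooth_on_imp_continuous_on[OF smooth_on_angle[OF w]]
          continuous_on_compose2[OF cr] smooth_on_imp_continuous_on[OF smooth_on_subset[OF smooth_on_log_norm V0]])
        auto
    then have "open ?O"
      by (rule continuous_open_preimage[OF _ open_slit]) (intro open_Times open_greaterThanLessThan open_greaterThan)
    moreover have "?O \<noteq> {}"
    proof -
      \<comment> \<open>A point of modulus 1 on the bisector, with \<open>cnj w\<close> undoing the
        rotation. Its logarithmic radius is 0, where \<open>radial 0\<close> takes the value
        \<open>Z 0 - Z 1\<close> = 1.\<close>
      define \<zeta> where "\<zeta> = cnj w * cis (- 3 * pi / 8)"
      define y :: "real ^ 2" where "y = vector [Re \<zeta>, Im \<zeta>]"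
      have "rot_complex w y = w * \<zeta>" by (simp add: rot_complex_def y_def)
      also have "\<dots> = (w * cnj w) * cis (- 3 * pi / 8)" by (simp only: \<zeta>_def mult.assoc)
      also have "w * cnj w = 1" unfolding complex_norm_square[symmetric] w by simp
      finally have z: "rot_complex w y = cis (- 3 * pi / 8)" by (simp only: mult_1)
      then have n: "norm y = 1" using norm_rot_complex[OF w, of y] by simp
      have "Ln (exp (\<i> * of_real (- 3 * pi / 8))) = \<i> * of_real (- 3 * pi / 8)"
        by (rule Ln_exp) (use pi_gt_zero in \<open>simp_all, linarith\<close>)
      then have a: "angle w y = - 3 * pi / 8"
        unfolding angle_def z cis_conv_exp by (simp only: Im_i_times Re_complex_of_real)
      have "rot_complex w y \<noteq> 0" by (simp add: z)
      moreover have "angle w y \<noteq> pi" using a pi_gt_zero by linarith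
      ultimately have "y \<in> ?V" using angle_eq_pi_iff by blast
      moreover have "radial 0 (log_norm y) > 0"
        using Z_left[of 0] Z_right[of 1] by (simp add: log_norm_def n radial_def)
      ultimately have "y \<in> ?O" by (simp add: a)
      then show ?thesis by blast
    qed
    ultimately have "\<not> negligible ?O" using open_not_negligible by blast
    moreover have "?O \<subseteq> {x. ?f x \<noteq> 0}"
    proof
      fix x assume x: "x \<in> ?O"
      then have "x \<in> ?W" "x \<noteq> 0" by (auto simp: wedge_def)
      moreover have "kern 0 x > 0" using x \<open>x \<noteq> 0\<close> by (simp add: kern_eq_exp)
      ultimately show "x \<in> {x. ?f x \<noteq> 0}" using c[of x] by simp
    qed
    moreover obtain N where "{x \<in> space lebesgue. \<not> ?f x = 0} \<subseteq> N" "N \<in> null_sets lebesgue"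
      using ae unfolding eventually_ae_filter by blast
    ultimately show False using negligible_subset[of N] by (auto simp: negligible_iff_null_sets)
  qed
  ultimately show ?thesis by simp
qed

text \<open>Two halvings leave 2 cos(\<mu> pi/4) times 2 cos(\<mu> pi/8) times a positive integral.
  For 0 < \<mu> < 4 only the first cosine can vanish, and only at \<mu> = 2, the value belonging to
  \<epsilon> = 0. Two halvings are enough because a wedge of width pi/4 is narrow for every such
  \<open>\<mu>\<close>.\<close>

lemma half_plane_integral_nonzero:
  assumes "0 < \<mu>" "\<mu> < 4" "\<mu> \<noteq> 2"
  shows "wedge_integral (- pi / 2) (pi / 2) 0 \<noteq> 0"
proof -
  have 1: "wedge_integral (- pi / 2) (pi / 2) 0
      = 2 * cos (\<mu> * pi / 4) * wedge_integral (- pi / 2) 0 (\<mu> * pi / 4)"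
    using wedge_integral_halve[of 0 "pi / 2" 0] by simp
  have 2: "wedge_integral (- pi / 2) 0 (\<mu> * pi / 4)
      = 2 * cos (\<mu> * pi / 8) * wedge_integral (- pi / 2) (- pi / 4) (3 * \<mu> * pi / 8)"
  proof -
    have "wedge_integral (- pi / 4 - pi / 4) (- pi / 4 + pi / 4) (\<mu> * pi / 4)
        = 2 * cos (\<mu> * (pi / 4) / 2) * wedge_integral (- pi / 4 - pi / 4) (- pi / 4) (\<mu> * pi / 4 + \<mu> * (pi / 4) / 2)"
      by (rule wedge_integral_halve) auto
    moreover have "- pi / 4 - pi / 4 = - pi / 2" "- pi / 4 + pi / 4 = 0"
      "\<mu> * (pi / 4) / 2 = \<mu> * pi / 8" "\<mu> * pi / 4 + \<mu> * pi / 8 = 3 * \<mu> * pi / 8" by simp_all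
    ultimately show ?thesis by (simp only:)
  qed
  have "cos (\<mu> * pi / 4) \<noteq> 0"
  proof
    assume "cos (\<mu> * pi / 4) = 0"
    then have c: "cos (\<mu> * pi / 4) = cos (pi / 2)" by simp
    have "\<mu> * pi \<le> 4 * pi" "0 \<le> \<mu> * pi" using assms by simp_all
    then have "\<mu> * pi / 4 = pi / 2" using pi_ge_zero by (intro cos_inj_pi[OF _ _ _ _ c]) linarith+
    then show False using assms by simp
  qed
  moreover have "cos (\<mu> * pi / 8) > 0"
  proof (rule cos_gt_zero_pi)
    have "\<mu> * pi < 4 * pi" "0 < \<mu> * pi" using assms by simp_all
    then show "- (pi / 2) < \<mu> * pi / 8" "\<mu> * pi / 8 < pi / 2" by linarith+
  qed
  ultimately show ?thesis using wedge_integral_pos[OF assms(1,2)] unfolding 1 2 by simp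
qed

section \<open>Convergence to the half-plane integral under rescaling\<close>

lemma norm_power2_test_fn: "(norm x)\<^sup>2 * test_fn a x = sector x * kern a x"
  by (simp add: test_fn_def kern_def mult_ac)

lemma sector_scale: "c > 0 \<Longrightarrow> sector (c *\<^sub>R x) = sector x"
  using angle_scale[OF _ _ w, of c x] by (simp add: sector_def linear_cmul[OF linear_rot_complex])

text \<open>On the edge Re = 0 of the half-plane the indicators of the rescaled sets need not
  converge, so the edge must be a null set.\<close>

lemma AE_Re_rot_complex: "AE x in lebesgue. Re (rot_complex w x) \<noteq> 0"
proof -
  define u :: "real ^ 2" where "u = vector [Re w, - Im w]"
  have u: "Re (rot_complex w x) = u \<bullet> x" for x
    by (simp add: u_def rot_complex_def inner_vec_def sum_2)
  have "u \<noteq> 0"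
  proof
    assume "u = 0"
    then have "u $ 1 = 0" "u $ 2 = 0" by simp_all
    then have "w = 0" by (simp add: u_def complex_eq_iff)
    then show False using w by simp
  qed
  then have "negligible {x. u \<bullet> x = 0}" by (intro negligible_hyperplane) simp
  then have "{x. u \<bullet> x = 0} \<in> null_sets lebesgue" by (simp add: negligible_iff_null_sets)
  then have "AE x in lebesgue. x \<notin> {x. u \<bullet> x = 0}" by (rule AE_not_in)
  then show ?thesis by (simp add: u)
qed

text \<open>The substitution x = exp(- t) y leaves t only in the indicator of the blown-up set,
  which converges off a line; the integrable kernel \<open>kern 0\<close> dominates.\<close>

lemma tendsto_half_plane_integral:
  assumes S: "S \<in> sets lebesgue"
    and ev: "\<And>y. Re (rot_complex w y) \<noteq> 0 \<Longrightarrow>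
      \<forall>\<^sub>F t in at_top. exp (- t) *\<^sub>R y \<in> S \<longleftrightarrow> Re (rot_complex w y) > 0"
  shows "((\<lambda>t. \<integral>x. indicator S x * ((norm x)\<^sup>2 * test_fn (- t) x) \<partial>lebesgue)
    \<longlongrightarrow> wedge_integral (- pi / 2) (pi / 2) 0) at_top"
proof -
  define s where "s t y = indicator S (exp (- t) *\<^sub>R y) * sector y * kern 0 y" for t y
  define f where "f y = indicator (wedge w (- pi / 2) (pi / 2)) y * cos (\<mu> * angle w y + 0) * kern 0 y" for y
  have sector_meas: "sector \<in> borel_measurable lebesgue" by (simp add: measurable_completion)
  have i0: "integrable lebesgue (\<lambda>x. indicator S x * sector x * kern a x)" for a
  proof (rule integrable_bounded_kern)
    show "(\<lambda>x. indicator S x * sector x) \<in> borel_measurable lebesgue"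
      using S by (intro borel_measurable_times sector_meas borel_measurable_indicator)
    show "\<bar>indicator S x * sector x\<bar> \<le> 1" for x
      using abs_sector_le_1[of x] by (auto simp: indicator_def)
  qed
  have sc: "indicator S (exp (- t) *\<^sub>R y) * sector (exp (- t) *\<^sub>R y) * kern (- t) (exp (- t) *\<^sub>R y)
      = s t y / (exp (- t))\<^sup>2" for t y
    using sector_scale[of "exp (- t)" y] kern_scale[of "exp (- t)" y] by (simp add: s_def)
  have int_s: "integrable lebesgue (s t)" for t
  proof -
    have "det (matrix ((*\<^sub>R) (exp (- t)) :: real ^ 2 \<Rightarrow> real ^ 2)) \<noteq> 0"
      by (simp add: matrix_scaleR det_2 mat_def)
    from lebesgue_integral_linear(1)[OF linear_scaleR this i0[of "- t"]]
    have "integrable lebesgue (\<lambda>y. (exp (- t))\<^sup>2 * (s t y / (exp (- t))\<^sup>2))"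
      unfolding sc by (rule integrable_mult_right)
    then show ?thesis by simp
  qed
  have eq: "(\<integral>x. indicator S x * ((norm x)\<^sup>2 * test_fn (- t) x) \<partial>lebesgue) = (\<integral>y. s t y \<partial>lebesgue)" for t
  proof -
    have "(\<integral>x. indicator S x * sector x * kern (- t) x \<partial>lebesgue)
        = (exp (- t))\<^sup>2 * (\<integral>y. s t y / (exp (- t))\<^sup>2 \<partial>lebesgue)"
      using lebesgue_integral_scale[OF exp_gt_zero i0[of "- t"], of "- t"] unfolding sc .
    then show ?thesis by (simp add: norm_power2_test_fn mult.assoc)
  qed
  have "((\<lambda>t. \<integral>y. s t y \<partial>lebesgue) \<longlongrightarrow> (\<integral>y. f y \<partial>lebesgue)) at_top"
  proof (rule integral_dominated_convergence_at_top)
    show "f \<in> borel_measurable lebesgue"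
      unfolding f_def using integrable_wedge by (rule borel_measurable_integrable)
    show "s t \<in> borel_measurable lebesgue" for t using int_s by (rule borel_measurable_integrable)
    show "integrable lebesgue (\<lambda>y. 1 * kern 0 y)" by (rule integrable_bounded_kern) auto
    have "\<bar>s t y\<bar> \<le> 1 * kern 0 y" for t y
    proof -
      have "\<bar>indicator S (exp (- t) *\<^sub>R y) * sector y\<bar> \<le> 1"
        using abs_sector_le_1[of y] by (auto simp: indicator_def)
      then have "\<bar>indicator S (exp (- t) *\<^sub>R y) * sector y\<bar> * \<bar>kern 0 y\<bar> \<le> 1 * \<bar>kern 0 y\<bar>"
        by (intro mult_right_mono) auto
      then show ?thesis using kern_nonneg[of 0 y] by (simp add: s_def abs_mult)
    qed
    then show "\<forall>\<^sub>F t in at_top. AE y in lebesgue. norm (s t y) \<le> 1 * kern 0 y" by simp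
    show "AE y in lebesgue. ((\<lambda>t. s t y) \<longlongrightarrow> f y) at_top"
      using AE_Re_rot_complex
    proof eventually_elim
      case (elim y)
      have y: "y \<noteq> 0" and z: "rot_complex w y \<noteq> 0" using elim by auto
      have "\<forall>\<^sub>F t in at_top. s t y = f y"
        using ev[OF elim]
      proof eventually_elim
        case (elim t)
        show ?case
        proof (cases "Re (rot_complex w y) > 0")
          case True
          then have "\<bar>angle w y\<bar> < pi / 2" using Re_Ln_pos_lt[OF z] by (simp add: angle_def)
          moreover have "rot_complex w y \<notin> \<real>\<^sub>\<le>\<^sub>0" using True by (auto simp: complex_nonpos_Reals_iff)
          ultimately have "y \<in> wedge w (- pi / 2) (pi / 2)" by (auto simp: wedge_def)
          moreover have "sector y = cos (\<mu> * angle w y)"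
            by (rule sector_eq_cos[OF y]) (use True norm_ge_zero[of y] in linarith)
          ultimately show ?thesis using True elim by (simp add: s_def f_def)
        next
          case False
          have "y \<notin> wedge w (- pi / 2) (pi / 2)"
          proof
            assume "y \<in> wedge w (- pi / 2) (pi / 2)"
            then have "cos (angle w y) \<ge> 0" by (intro cos_ge_zero) (auto simp: wedge_def)
            then have "Re (rot_complex w y) \<ge> 0" by (simp add: Re_rot_complex[OF w])
            then show False using False \<open>Re (rot_complex w y) \<noteq> 0\<close> by simp
          qed
          then show ?thesis using False elim by (simp add: s_def f_def)
        qed
      qed
      then show ?case by (rule tendsto_eventually)
    qed
  qed
  then show ?thesis unfolding eq f_def wedge_integral_def .
qed

end

section \<open>Logarithmic growth\<close>

text \<open>Steps that are eventually close to C \<noteq> 0 have one sign and add up linearly. The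
  times \<open>r k\<close> need not differ by integers, so each is walked back by unit steps into
  [T, T + 1], where local boundedness of J controls the starting value.\<close>

lemma unbounded_if_steps_converge:
  fixes J :: "real \<Rightarrow> real"
  assumes lim: "((\<lambda>t. J t - J (t + 1)) \<longlongrightarrow> C) at_top" and C: "C \<noteq> 0"
    and loc: "\<forall>\<^sub>F T in at_top. \<exists>B. \<forall>t\<in>{T..T + 1}. \<bar>J t\<bar> \<le> B"
    and r: "filterlim r at_top sequentially" and bd: "\<forall>\<^sub>F k in sequentially. \<bar>J (r k)\<bar> \<le> M"
  shows False
proof -
  define c where "c = \<bar>C\<bar> / 2"
  have c: "c > 0" using C by (simp add: c_def)
  have "\<forall>\<^sub>F t in at_top. dist (J t - J (t + 1)) C < c" using lim c by (rule tendstoD)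
  then have "\<forall>\<^sub>F t in at_top. sgn C * (J t - J (t + 1)) \<ge> c"
  proof eventually_elim
    case (elim t)
    then show ?case using C by (cases "C > 0") (auto simp: c_def dist_real_def sgn_if abs_if split: if_splits)
  qed
  then have "\<forall>\<^sub>F T in at_top. \<forall>t\<ge>T. sgn C * (J t - J (t + 1)) \<ge> c"
    by (rule eventually_all_ge_at_top)
  then have "\<forall>\<^sub>F T in at_top. (\<forall>t\<ge>T. sgn C * (J t - J (t + 1)) \<ge> c) \<and> (\<exists>B. \<forall>t\<in>{T..T + 1}. \<bar>J t\<bar> \<le> B)"
    using loc by (rule eventually_conj)
  then obtain T where "(\<forall>t\<ge>T. sgn C * (J t - J (t + 1)) \<ge> c) \<and> (\<exists>B. \<forall>t\<in>{T..T + 1}. \<bar>J t\<bar> \<le> B)"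
    unfolding eventually_at_top_linorder by blast
  then have T: "\<And>t. t \<ge> T \<Longrightarrow> sgn C * (J t - J (t + 1)) \<ge> c"
    and "\<exists>B. \<forall>t\<in>{T..T + 1}. \<bar>J t\<bar> \<le> B" by blast+
  then obtain B where "\<forall>t\<in>{T..T + 1}. \<bar>J t\<bar> \<le> B" by blast
  then have B: "\<And>t. T \<le> t \<Longrightarrow> t \<le> T + 1 \<Longrightarrow> \<bar>J t\<bar> \<le> B" by simp
  have steps: "sgn C * (J t - J (t + real n)) \<ge> real n * c" if "t \<ge> T" for t n
  proof (induction n)
    case (Suc n)
    have "sgn C * (J (t + real n) - J (t + real n + 1)) \<ge> c" using that by (intro T) simp
    with Suc show ?case by (simp add: algebra_simps)
  qed simp
  have grow: "(t - T - 1) * c \<le> B + \<bar>J t\<bar>" if "t \<ge> T" for t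
  proof -
    define n where "n = nat \<lfloor>t - T\<rfloor>"
    have n: "real n \<le> t - T" "t - T < real n + 1" using that by (simp_all add: n_def)
    have "real n * c \<le> sgn C * (J (t - real n) - J t)"
      using steps[of "t - real n" n] n by simp
    also have "\<dots> \<le> \<bar>sgn C * (J (t - real n) - J t)\<bar>" by (rule abs_ge_self)
    also have "\<dots> \<le> \<bar>J (t - real n)\<bar> + \<bar>J t\<bar>"
      using C by (simp add: abs_mult abs_sgn_eq)
    also have "\<dots> \<le> B + \<bar>J t\<bar>" using B[of "t - real n"] n by simp
    finally have "real n * c \<le> B + \<bar>J t\<bar>" .
    moreover have "(t - T - 1) * c \<le> real n * c" using n c by (intro mult_right_mono) auto
    ultimately show ?thesis by linarith
  qed
  \<comment> \<open>Of the 2 in the threshold, one unit pays for the loss in \<open>grow\<close> and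
    the other leaves a surplus c that makes the contradiction strict.\<close>
  have "\<forall>\<^sub>F k in sequentially. r k \<ge> max T (T + 2 + (B + M) / c)"
    using r unfolding filterlim_at_top by blast
  with bd have "\<forall>\<^sub>F k in sequentially. False"
  proof eventually_elim
    case (elim k)
    have "c + (B + M) = (1 + (B + M) / c) * c" using c by (simp add: field_simps)
    also have "\<dots> \<le> (r k - T - 1) * c" using elim c by (intro mult_right_mono) auto
    also have "\<dots> \<le> B + M" using grow[of "r k"] elim by simp
    finally show False using c by simp
  qed
  then show False by simp
qed

lemma integrable_abs_L1_loc_cball:
  assumes "L1_loc U v" "cball 0 R \<subseteq> U"
  shows "integrable lebesgue (\<lambda>x. \<bar>v x\<bar> * indicator (cball 0 R) x)"
proof -
  have "integrable lebesgue (\<lambda>x. v x * indicator (cball 0 R) x)"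
  proof (rule integrable_L1_loc_mult[OF assms(1) compact_cball assms(2)])
    show "indicator (cball 0 R) \<in> borel_measurable (lebesgue :: (real ^ 'a) measure)"
      by (rule borel_measurable_indicator) simp
    show "\<bar>indicator (cball 0 R) x\<bar> \<le> (1 :: real)" for x :: "real ^ 'a" by (simp add: indicator_def)
  qed simp
  from integrable_abs[OF this] show ?thesis by (simp add: abs_mult)
qed

context cutoff_data
begin

lemma weight_integral_le_integral_abs:
  assumes v: "L1_loc (ball 0 1) v" and B: "\<And>a x. \<bar>weight_fn a x\<bar> \<le> B * exp (- 4 * a)"
    and a: "exp (a + 1) \<le> R" "R < 1"
  shows "\<bar>\<integral>x. v x * weight_fn a x \<partial>lebesgue\<bar>
    \<le> B * exp (- 4 * a) * (\<integral>x. \<bar>v x\<bar> * indicator (cball 0 R) x \<partial>lebesgue)"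
proof -
  have R: "cball 0 R \<subseteq> ball (0 :: real ^ 2) 1" using a by (simp add: cball_subset_ball_iff)
  note iv = integrable_abs_L1_loc_cball[OF v R]
  have "exp (a + 1) < 1" using a by linarith
  then have a1: "a + 1 < 0" by simp
  have "\<bar>\<integral>x. v x * weight_fn a x \<partial>lebesgue\<bar> \<le> (\<integral>x. \<bar>v x * weight_fn a x\<bar> \<partial>lebesgue)"
    by (rule integral_abs_bound)
  also have "\<dots> \<le> (\<integral>x. B * exp (- 4 * a) * (\<bar>v x\<bar> * indicator (cball 0 R) x) \<partial>lebesgue)"
  proof (rule integral_mono)
    show "integrable lebesgue (\<lambda>x. \<bar>v x * weight_fn a x\<bar>)"
      using integrable_weight_fn[OF v a1] by (rule integrable_abs)
    show "integrable lebesgue (\<lambda>x. B * exp (- 4 * a) * (\<bar>v x\<bar> * indicator (cball 0 R) x))"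
      using iv by (rule integrable_mult_right)
    show "\<bar>v x * weight_fn a x\<bar> \<le> B * exp (- 4 * a) * (\<bar>v x\<bar> * indicator (cball 0 R) x)" for x
    proof (cases "x \<in> cball 0 R")
      case True
      then show ?thesis
        using mult_left_mono[OF B[of a x] abs_ge_zero[of "v x"]] by (simp add: abs_mult mult_ac)
    next
      case False
      then have "weight_fn a x = 0" using a by (intro weight_fn_eq_0) auto
      then show ?thesis using False by simp
    qed
  qed
  finally show ?thesis by simp
qed

text \<open>A count of scales: the weight is of order r^-4, v is at most M r^2, and the disc of
  radius e r has area of order r^2. The factor e is the outer radius of the annulus for a = ln r,
  relative to r.\<close>

lemma weight_integral_blow_up_bound:
  assumes v: "L1_loc (ball 0 1) v" and B: "\<And>a x. \<bar>weight_fn a x\<bar> \<le> B * exp (- 4 * a)" "B \<ge> 0"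
    and r: "r > 0" "exp 1 * r < 1" and M: "\<And>y. y \<in> cball 0 (exp 1) \<Longrightarrow> \<bar>rescale v r y\<bar> \<le> M"
  shows "\<bar>\<integral>x. v x * weight_fn (ln r) x \<partial>lebesgue\<bar> \<le> B * M * (unit_ball_vol 2 * (exp 1)\<^sup>2)"
proof -
  let ?R = "exp 1 * r"
  have "(\<integral>x. \<bar>v x\<bar> * indicator (cball 0 ?R) x \<partial>lebesgue) \<le> (\<integral>x. M * r\<^sup>2 * indicator (cball (0 :: real ^ 2) ?R) x \<partial>lebesgue)"
  proof (rule integral_mono)
    have R: "cball 0 ?R \<subseteq> ball (0 :: real ^ 2) 1" using r by (simp add: cball_subset_ball_iff)
    show "integrable lebesgue (\<lambda>x. \<bar>v x\<bar> * indicator (cball 0 ?R) x)"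
      by (rule integrable_abs_L1_loc_cball[OF v R])
    show "integrable lebesgue (\<lambda>x. M * r\<^sup>2 * indicator (cball (0 :: real ^ 2) ?R) x)"
      using lmeasurable_cball[of "0 :: real ^ 2" ?R]
      by (intro integrable_mult_right) (simp add: integrable_indicator_iff fmeasurable_def)
    show "\<bar>v x\<bar> * indicator (cball 0 ?R) x \<le> M * r\<^sup>2 * indicator (cball (0 :: real ^ 2) ?R) x" for x
    proof (cases "x \<in> cball 0 ?R")
      case True
      then have "(1 / r) *\<^sub>R x \<in> cball 0 (exp 1)" using r by (simp add: field_simps)
      from M[OF this] have "\<bar>v x\<bar> / r\<^sup>2 \<le> M" using r by (simp add: rescale_def)
      then show ?thesis using True r by (simp add: field_simps)
    qed simp
  qed
  also have "\<dots> = M * r\<^sup>2 * (unit_ball_vol 2 * ?R\<^sup>2)"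
    using content_cball[of ?R "0 :: real ^ 2"] r by simp
  finally have i: "(\<integral>x. \<bar>v x\<bar> * indicator (cball 0 ?R) x \<partial>lebesgue) \<le> M * r\<^sup>2 * (unit_ball_vol 2 * ?R\<^sup>2)" .
  have e: "exp (- 4 * ln r) = 1 / r ^ 4"
  proof -
    have "exp (4 * ln r) = r ^ 4" using r exp_of_nat_mult[of 4 "ln r"] by simp
    then show ?thesis by (simp add: exp_minus divide_inverse)
  qed
  have "exp (ln r + 1) = ?R" using r by (simp add: exp_add)
  then have "\<bar>\<integral>x. v x * weight_fn (ln r) x \<partial>lebesgue\<bar>
      \<le> B * exp (- 4 * ln r) * (\<integral>x. \<bar>v x\<bar> * indicator (cball 0 ?R) x \<partial>lebesgue)"
    using r by (intro weight_integral_le_integral_abs v B) auto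
  also have "\<dots> \<le> B * exp (- 4 * ln r) * (M * r\<^sup>2 * (unit_ball_vol 2 * ?R\<^sup>2))"
    using B(2) by (intro mult_left_mono i) auto
  also have "\<dots> = B * M * (unit_ball_vol 2 * (exp 1)\<^sup>2)"
    unfolding e using r by (simp add: field_simps power2_eq_square power4_eq_xxxx)
  finally show ?thesis .
qed

end

text \<open>A continuous limit is bounded on a closed ball, and uniform convergence passes this on
  to the blow-ups with one unit to spare. This is quadratic growth of v along the scales
  \<open>r k\<close>.\<close>

lemma blow_up_bounded:
  assumes "nondegenerate_at_0 v"
  obtains r M where "\<And>k. r k > 0" "r \<longlonglongrightarrow> (0 :: real)"
    "\<forall>\<^sub>F k in sequentially. \<forall>y\<in>cball 0 R. \<bar>rescale v (r k) y\<bar> \<le> M"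
proof -
  obtain r v0 s where r: "\<And>k. r k > 0" "r \<longlonglongrightarrow> 0" and s: "strict_mono s"
    and lim: "C1_loc_limit (\<lambda>k. rescale v (r (s k))) v0"
    using assms by (auto simp: nondegenerate_at_0_def blow_up_limit_def)
  have "Ck_on (Suc 0) UNIV v0" using lim by (simp add: C1_loc_limit_def)
  then have "continuous_on UNIV v0" by (auto dest: Ck_on_SucD simp del: Ck_on.simps(2))
  then have "compact (v0 ` cball 0 R)"
    by (intro compact_continuous_image) (auto intro: continuous_on_subset)
  then obtain M where M: "\<forall>y\<in>v0 ` cball 0 R. \<bar>y\<bar> \<le> M"
    using compact_imp_bounded bounded_real by blast
  have "uniform_limit (cball 0 R) (\<lambda>k. rescale v (r (s k))) v0 sequentially"
    using lim by (simp add: C1_loc_limit_def)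
  from uniform_limitD[OF this zero_less_one]
  have "\<forall>\<^sub>F k in sequentially. \<forall>y\<in>cball 0 R. \<bar>rescale v (r (s k)) y\<bar> \<le> M + 1"
  proof eventually_elim
    case (elim k)
    show ?case
    proof
      fix y assume y: "y \<in> cball (0 :: real ^ 2) R"
      then have "\<bar>rescale v (r (s k)) y - v0 y\<bar> < 1" "\<bar>v0 y\<bar> \<le> M"
        using elim M by (auto simp: dist_real_def)
      then show "\<bar>rescale v (r (s k)) y\<bar> \<le> M + 1" by linarith
    qed
  qed
  moreover have "(\<lambda>k. r (s k)) \<longlonglongrightarrow> 0"
    using LIMSEQ_subseq_LIMSEQ[OF r(2) s] by (simp add: o_def)
  ultimately show ?thesis using r(1) by (intro that[of "\<lambda>k. r (s k)" "M + 1"])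
qed

text \<open>The rotation is encoded as multiplication by a unit complex number, composed with a quarter turn
  that moves the lower half-plane to the right half-plane.\<close>

lemma rotation_matrix_eq_rot_complex:
  fixes Q :: "real ^ 2 ^ 2"
  assumes "rotation_matrix Q"
  obtains w where "cmod w = 1" "\<And>x. (Q *v x) $ 1 = Im (rot_complex w x)" "\<And>x. (Q *v x) $ 2 = - Re (rot_complex w x)"
proof -
  define a b c d where "a = Q $ 1 $ 1" and "b = Q $ 1 $ 2" and "c = Q $ 2 $ 1" and "d = Q $ 2 $ 2"
  have "transpose Q ** Q = mat 1" and det: "det Q = 1"
    using assms by (auto simp: rotation_matrix_def orthogonal_matrix)
  then have "(transpose Q ** Q) $ i $ j = (if i = j then 1 else 0)" for i j by (simp add: mat_def)
  from this[of 1 1] this[of 2 2] have 1: "a * a + c * c = 1" "b * b + d * d = 1"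
    by (simp_all add: matrix_matrix_mult_def transpose_def sum_2 a_def b_def c_def d_def)
  have 2: "a * d - b * c = 1" using det by (simp add: det_2 a_def b_def c_def d_def)
  \<comment> \<open>Expanded, this is the sum of the squared lengths of the two columns minus twice
    the determinant, 1 + 1 - 2.\<close>
  have "(a - d)\<^sup>2 + (b + c)\<^sup>2 = 0" using 1 2 by (simp add: power2_eq_square algebra_simps)
  then have 3: "a = d" "b = - c" by (simp_all add: sum_power2_eq_zero_iff)
  show ?thesis
  proof (rule that[of "Complex (- c) a"])
    show "cmod (Complex (- c) a) = 1" using 1 by (simp add: cmod_def power2_eq_square add.commute)
    show "(Q *v x) $ 1 = Im (rot_complex (Complex (- c) a) x)" for x
      using 3 by (simp add: matrix_vector_mult_def sum_2 rot_complex_def a_def[symmetric] b_def[symmetric])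
    show "(Q *v x) $ 2 = - Re (rot_complex (Complex (- c) a) x)" for x
      using 3 by (simp add: matrix_vector_mult_def sum_2 rot_complex_def c_def[symmetric] d_def[symmetric])
  qed
qed

section \<open>Choice of the data and the contradiction\<close>

theorem theorem1p5:
  "\<exists>\<epsilon>\<^sub>0 > 0. \<forall>\<epsilon>::real. \<epsilon> \<noteq> 0 \<and> \<bar>\<epsilon>\<bar> < \<epsilon>\<^sub>0 \<longrightarrow>
     (\<forall>v :: real ^ 2 \<Rightarrow> real.
        (\<forall>x \<in> ball 0 1. v x \<ge> 0) \<and>
        strong_solution (coeff_matrix \<epsilon>) v \<and>
        0 \<in> frontier (positivity_set v) \<and>
        nondegenerate_at_0 v \<longrightarrow>
        \<not> boundary_differentiable_at_0 (positivity_set v))"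
\<comment> \<open>The value 1/2 is a convenient choice: it gives 1 + \<epsilon> > 0 and \<mu> < 4,
  the latter being equivalent to \<epsilon> > -6/7 once the former holds and \<mu> is real.\<close>
proof (intro exI[of _ "1 / 2 :: real"] conjI allI impI notI; (elim conjE)?)
  fix \<epsilon> :: real and v :: "real ^ 2 \<Rightarrow> real"
  assume \<epsilon>: "\<epsilon> \<noteq> 0" "\<bar>\<epsilon>\<bar> < 1 / 2" and nonneg: "\<forall>x \<in> ball 0 1. v x \<ge> 0"
    and sol: "strong_solution (coeff_matrix \<epsilon>) v" and nondeg: "nondegenerate_at_0 v"
    and diff: "boundary_differentiable_at_0 (positivity_set v)"
  define S where "S = positivity_set v"
  obtain Q \<phi> where Q: "rotation_matrix Q" and \<phi>: "\<phi> 0 = 0" "(\<phi> has_real_derivative 0) (at 0)"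
    and evS: "\<forall>\<^sub>F x in nhds 0. x \<in> S \<longleftrightarrow> (Q *v x) $ 2 < \<phi> ((Q *v x) $ 1)"
    using diff by (auto simp: boundary_differentiable_at_0_def S_def)
  obtain w where w: "cmod w = 1" and Q1: "\<And>x. (Q *v x) $ 1 = Im (rot_complex w x)"
    and Q2: "\<And>x. (Q *v x) $ 2 = - Re (rot_complex w x)"
    using rotation_matrix_eq_rot_complex[OF Q] by blast
  have \<phi>_small: "\<exists>\<delta>>0. \<forall>t. \<bar>t\<bar> < \<delta> \<longrightarrow> \<bar>\<phi> t\<bar> \<le> \<eta> * \<bar>t\<bar>" if "\<eta> > 0" for \<eta>
    using \<phi>(2)[unfolded has_field_derivative_def has_derivative_at_alt] that \<phi>(1)
    by auto
  obtain \<rho>0 where \<rho>0: "\<rho>0 > 0" "\<And>x. norm x < \<rho>0 \<Longrightarrow> x \<in> S \<longleftrightarrow> - Re (rot_complex w x) < \<phi> (Im (rot_complex w x))"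
    using evS unfolding eventually_nhds_metric Q1 Q2 by (auto simp: dist_norm)
  \<comment> \<open>Slope 1/8 lies below the aperture 1/4 within which the angular cutoff equals
    1.\<close>
  obtain \<delta> where \<delta>: "\<delta> > 0" "\<And>t. \<bar>t\<bar> < \<delta> \<Longrightarrow> \<bar>\<phi> t\<bar> \<le> 1 / 8 * \<bar>t\<bar>"
    using \<phi>_small[of "1 / 8"] by auto
  define \<rho> where "\<rho> = min (min \<rho>0 \<delta>) 1"
  have \<rho>: "\<rho> > 0" "\<rho> \<le> 1" using \<rho>0(1) \<delta>(1) by (auto simp: \<rho>_def)
  have Im_le: "\<bar>Im (rot_complex w x)\<bar> \<le> norm x" for x
    using abs_Im_le_cmod[of "rot_complex w x"] by (simp add: norm_rot_complex[OF w])
  have cone: "- Re (rot_complex w x) < norm x / 4" if "x \<in> S" "norm x < \<rho>" "x \<noteq> 0" for x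
  proof -
    have "- Re (rot_complex w x) < \<phi> (Im (rot_complex w x))" using that \<rho>0(2)[of x] by (simp add: \<rho>_def)
    moreover have "\<bar>\<phi> (Im (rot_complex w x))\<bar> \<le> 1 / 8 * \<bar>Im (rot_complex w x)\<bar>"
      using that Im_le[of x] by (intro \<delta>(2)) (simp add: \<rho>_def)
    moreover have "norm x > 0" using that by simp
    ultimately show ?thesis using Im_le[of x] by linarith
  qed
  obtain Z Z1 Z2 :: "real \<Rightarrow> real" where Z: "\<forall>t. (Z has_real_derivative Z1 t) (at t)"
     "\<forall>t. (Z1 has_real_derivative Z2 t) (at t)" "continuous_on UNIV Z2"
     "\<forall>t\<le>0. Z t = 1 \<and> Z1 t = 0 \<and> Z2 t = 0" "\<forall>t\<ge>1. Z t = 0 \<and> Z1 t = 0 \<and> Z2 t = 0" "antimono Z"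
     "\<forall>(U :: (real ^ 2) set) f. open U \<longrightarrow> smooth_on U f \<longrightarrow> smooth_on U (\<lambda>x. Z (f x))"
    using smooth_step_exists[where ?'n = 2] by (elim exE conjE) (rule that)
  define \<mu> where "\<mu> = sqrt ((4 + 2 * \<epsilon>) / (1 + \<epsilon>))"
  have e1: "1 + \<epsilon> > 0" "4 + 2 * \<epsilon> > 0" using \<epsilon>(2) by linarith+
  have \<mu>2: "\<mu>\<^sup>2 = (4 + 2 * \<epsilon>) / (1 + \<epsilon>)" using e1 by (simp add: \<mu>_def)
  have \<mu>_range: "0 < \<mu>" "\<mu> < 4" "\<mu> \<noteq> 2"
  proof -
    show "0 < \<mu>" using e1 by (simp add: \<mu>_def)
    have "\<mu>\<^sup>2 < 4\<^sup>2" unfolding \<mu>2 using e1 \<epsilon>(2) by (simp add: field_simps)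
    then show "\<mu> < 4" by (rule power_less_imp_less_base) simp
    show "\<mu> \<noteq> 2"
    proof
      assume "\<mu> = 2"
      then have "(4 + 2 * \<epsilon>) / (1 + \<epsilon>) = 4" using \<mu>2 by simp
      then show False using e1 \<epsilon>(1) by (simp add: field_simps)
    qed
  qed
  interpret cutoff_data Z Z1 Z2 w \<epsilon> \<mu>
    by unfold_locales (use Z w e1 in \<open>simp_all add: \<mu>2\<close>)
  have L1: "L1_loc (ball 0 1) v"
    using sol by (auto simp: strong_solution_def W22_loc_with_def weak_partial_deriv_def)
  \<comment> \<open>The logarithmic scale is reversed, t = - a: the origin is approached as t tends
    to infinity, and the telescoping difference reads J t - J (t + 1).\<close>
  define J where "J t = (\<integral>x. v x * weight_fn (- t) x \<partial>lebesgue)" for t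
  obtain B where B: "B \<ge> 0" "\<And>a x. \<bar>weight_fn a x\<bar> \<le> B * exp (- 4 * a)" by (rule weight_fn_bounded) blast
  obtain r M where r: "\<And>k. r k > 0" "r \<longlonglongrightarrow> (0 :: real)"
    and M: "\<forall>\<^sub>F k in sequentially. \<forall>y\<in>cball 0 (exp 1). \<bar>rescale v (r k) y\<bar> \<le> M"
    by (rule blow_up_bounded[OF nondeg, of "exp 1"]) blast
  show False
  proof (rule unbounded_if_steps_converge[where J = J])
    have "((\<lambda>t. \<integral>x. indicator S x * ((norm x)\<^sup>2 * test_fn (- t) x) \<partial>lebesgue)
      \<longlongrightarrow> wedge_integral (- pi / 2) (pi / 2) 0) at_top"
    proof (rule tendsto_half_plane_integral)
      show "S \<in> sets lebesgue" unfolding S_def by (rule positivity_set_measurable[OF L1])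
      fix y assume y: "Re (rot_complex w y) \<noteq> 0"
      define R I where "R = Re (rot_complex w y)" and "I = Im (rot_complex w y)"
      \<comment> \<open>With this slope, \<phi> at height c I is at most c |R| |I| / (2 (|I| + 1)) <
        c |R|, so the sign of R decides membership in S. The added 1 avoids a zero denominator when
        I = 0.\<close>
      have "\<bar>R\<bar> / (2 * (\<bar>I\<bar> + 1)) > 0" using y by (simp add: R_def)
      from \<phi>_small[OF this] obtain \<delta>' where \<delta>': "\<delta>' > 0"
        "\<And>t. \<bar>t\<bar> < \<delta>' \<Longrightarrow> \<bar>\<phi> t\<bar> \<le> \<bar>R\<bar> / (2 * (\<bar>I\<bar> + 1)) * \<bar>t\<bar>" by auto
      have l: "((\<lambda>t. exp (- t) * k) \<longlongrightarrow> 0 * k) at_top" for k :: real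
        by (intro tendsto_mult tendsto_const filterlim_compose[OF exp_at_bot filterlim_uminus_at_bot_at_top])
      have "\<forall>\<^sub>F t in at_top. exp (- t) * norm y < \<rho>0" "\<forall>\<^sub>F t in at_top. exp (- t) * \<bar>I\<bar> < \<delta>'"
        using order_tendstoD(2)[OF l[of "norm y"], of \<rho>0] order_tendstoD(2)[OF l[of "\<bar>I\<bar>"], of \<delta>'] \<rho>0(1) \<delta>'(1)
        by simp_all
      then show "\<forall>\<^sub>F t in at_top. exp (- t) *\<^sub>R y \<in> S \<longleftrightarrow> Re (rot_complex w y) > 0"
      proof eventually_elim
        case (elim t)
        let ?c = "exp (- t)"
        have "?c *\<^sub>R y \<in> S \<longleftrightarrow> - (?c * R) < \<phi> (?c * I)"
          using \<rho>0(2)[of "?c *\<^sub>R y"] elim(1) linear_cmul[OF linear_rot_complex, of w ?c y]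
          by (simp add: R_def I_def)
        moreover have "\<bar>\<phi> (?c * I)\<bar> < ?c * \<bar>R\<bar>"
        proof -
          have "\<bar>\<phi> (?c * I)\<bar> \<le> \<bar>R\<bar> / (2 * (\<bar>I\<bar> + 1)) * \<bar>?c * I\<bar>"
            using elim(2) by (intro \<delta>'(2)) (simp add: abs_mult)
          also have "\<dots> = ?c * \<bar>R\<bar> * (\<bar>I\<bar> / (2 * (\<bar>I\<bar> + 1)))" by (simp add: abs_mult)
          also have "\<dots> < ?c * \<bar>R\<bar> * 1"
            using y by (intro mult_strict_left_mono) (simp_all add: R_def field_simps)
          finally show ?thesis by simp
        qed
        ultimately show ?case
        proof (cases "R > 0")
          case True
          then have "?c * R > 0" by simp
          with \<open>\<bar>\<phi> (?c * I)\<bar> < ?c * \<bar>R\<bar>\<close> \<open>?c *\<^sub>R y \<in> S \<longleftrightarrow> - (?c * R) < \<phi> (?c * I)\<close> True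
          show ?thesis unfolding R_def[symmetric] by auto
        next
          case False
          with \<open>\<bar>\<phi> (?c * I)\<bar> < ?c * \<bar>R\<bar>\<close> \<open>?c *\<^sub>R y \<in> S \<longleftrightarrow> - (?c * R) < \<phi> (?c * I)\<close>
          show ?thesis unfolding R_def[symmetric] by auto
        qed
      qed
    qed
    moreover have "\<forall>\<^sub>F t in at_top. (\<integral>x. indicator S x * ((norm x)\<^sup>2 * test_fn (- t) x) \<partial>lebesgue) = J t - J (t + 1)"
      \<comment> \<open>Beyond this t the support of \<open>test_fn (- t)\<close>, which reaches out
        to radius exp(1 - t), lies in the ball where the cone condition holds.\<close>
      using eventually_gt_at_top[of "1 - ln \<rho>"]
    proof eventually_elim
      case (elim t)
      then have "- t + 1 < ln \<rho>" by simp
      then have "exp (- t + 1) < exp (ln \<rho>)" by (simp only: exp_less_cancel_iff)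
      then have "exp (- t + 1) < \<rho>" using \<rho> by simp
      from telescoping[OF sol nonneg \<rho>(2) _ this] cone show ?case by (simp add: J_def S_def)
    qed
    ultimately show "((\<lambda>t. J t - J (t + 1)) \<longlongrightarrow> wedge_integral (- pi / 2) (pi / 2) 0) at_top"
      by (rule Lim_transform_eventually)
    show "wedge_integral (- pi / 2) (pi / 2) 0 \<noteq> 0" using \<mu>_range by (rule half_plane_integral_nonzero)
    show "\<forall>\<^sub>F T in at_top. \<exists>B. \<forall>t\<in>{T..T + 1}. \<bar>J t\<bar> \<le> B"
      \<comment> \<open>For T > 1 the annuli for all t in [T, T + 1] lie in the closed ball of
        radius exp(1 - T) < 1, on which v is integrable.\<close>
      using eventually_gt_at_top[of 1]
    proof eventually_elim
      case (elim T)
      define I where "I = (\<integral>x. \<bar>v x\<bar> * indicator (cball 0 (exp (1 - T))) x \<partial>lebesgue)"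
      have I: "I \<ge> 0" unfolding I_def by (rule Bochner_Integration.integral_nonneg) simp
      have "\<bar>J t\<bar> \<le> B * exp (4 * (T + 1)) * I" if "t \<in> {T..T + 1}" for t
      proof -
        have "\<bar>J t\<bar> \<le> B * exp (- 4 * (- t)) * I"
          unfolding J_def I_def by (rule weight_integral_le_integral_abs[OF L1 B(2)]) (use that elim in auto)
        also have "\<dots> \<le> B * exp (4 * (T + 1)) * I"
          using that B(1) I by (intro mult_right_mono mult_left_mono) auto
        finally show ?thesis .
      qed
      then show ?case by blast
    qed
    have "filterlim r (at_right 0) sequentially"
      using r by (intro tendsto_imp_filterlim_at_right always_eventually allI)
    from filterlim_compose[OF ln_at_0 this]
    show "filterlim (\<lambda>k. - ln (r k)) at_top sequentially" by (simp add: filterlim_uminus_at_bot)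
    have "\<forall>\<^sub>F k in sequentially. r k < exp (- 1)" using order_tendstoD(2)[OF r(2)] by simp
    with M show "\<forall>\<^sub>F k in sequentially. \<bar>J (- ln (r k))\<bar> \<le> B * M * (unit_ball_vol 2 * (exp 1)\<^sup>2)"
    proof eventually_elim
      case (elim k)
      have "exp 1 * r k < exp 1 * exp (- 1)" using elim by simp
      then have "exp 1 * r k < 1" by (simp add: exp_minus)
      with elim show ?case
        unfolding J_def minus_minus by (intro weight_integral_blow_up_bound L1 B r(1)) auto
    qed
  qed
qed simp

end
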